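(* Let $A\in\mathfrak{H}_n$ and $B\in\mathfrak{M}_n$. Let $\lambda_{\min}$ and $\lambda_{\max}$ be the smallest and the largest eigenvalues of $A$, and let $\mathfrak{B}$ be the $\sigma$-algebra of Borel subsets of the closed interval $[\lambda_{\min},\lambda_{\max}]$. Then there exists a set function $M:\mathfrak{B}\to\mathfrak{M}_n$ such that: (1) $M$ is countably additive and regular on $\mathfrak{B}$, i.e. $M$ is a regular Borel $\mathfrak{M}_n$-valued measure on $[\lambda_{\min},\lambda_{\max}]$; (2) for every $t\in\mathbb{C}$, \[ e^{tA+B}=\int_{[\lambda_{\min},\lambda_{\max}]} e^{t\lambda}\,M(d\lambda); \] (3) if moreover $B\in\mathfrak{H}_n$, then $M$ is $\mathfrak{H}_n$-valued, i.e. $M(\delta)\in\mathfrak{H}_n$ for every $\delta\in\mathfrak{B}$.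
   Context: $\mathfrak{M}_n$ denotes the set of complex $n\times n$ matrices, $\mathfrak{H}_n$ the set of Hermitian $n\times n$ matrices. For a matrix-valued measure the integral is taken entrywise. *)

theory Defs
  imports "HOL-Analysis.Analysis"
begin

definition hermitian :: "complex^'n^'n \<Rightarrow> bool" where
  "hermitian A \<longleftrightarrow> (\<forall>i j. A$i$j = cnj (A$j$i))"

definition is_eigenvalue :: "complex^'n^'n \<Rightarrow> complex \<Rightarrow> bool" where
  "is_eigenvalue A c \<longleftrightarrow> (\<exists>v. v \<noteq> 0 \<and> A *v v = c *s v)"

definition cscale :: "complex \<Rightarrow> complex^'n^'n \<Rightarrow> complex^'n^'n" where
  "cscale c A = (\<chi> i j. c * A$i$j)"

fun mpow :: "complex^'n^'n \<Rightarrow> nat \<Rightarrow> complex^'n^'n" where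
  "mpow A 0 = mat 1"
| "mpow A (Suc k) = A ** mpow A k"

definition mexp :: "complex^'n^'n \<Rightarrow> complex^'n^'n" where
  "mexp A = (\<Sum>k. (1 / fact k) *\<^sub>R mpow A k)"

definition borel_subsets :: "real set \<Rightarrow> real set set" where
  "borel_subsets S = {E. E \<in> sets borel \<and> E \<subseteq> S}"

definition vmeasure_cadd :: "real set \<Rightarrow> (real set \<Rightarrow> complex^'n^'n) \<Rightarrow> bool" where
  "vmeasure_cadd S M \<longleftrightarrow>
     (\<forall>F :: nat \<Rightarrow> real set. range F \<subseteq> borel_subsets S \<longrightarrow> disjoint_family F \<longrightarrow>
        (\<lambda>k. M (F k)) sums M (\<Union>k. F k))"

text \<open>Regularity (Dunford--Schwartz III.5.11): for every Borel E and e > 0 there are a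
  compact K \<subseteq> E and a relatively open U \<supseteq> E with norm (M F) < e for all Borel F \<subseteq> U - K.\<close>
definition vmeasure_regular :: "real set \<Rightarrow> (real set \<Rightarrow> complex^'n^'n) \<Rightarrow> bool" where
  "vmeasure_regular S M \<longleftrightarrow>
     (\<forall>E \<in> borel_subsets S. \<forall>e>0. \<exists>K U. compact K \<and> K \<subseteq> E \<and> openin (top_of_set S) U \<and> E \<subseteq> U \<and>
        (\<forall>F \<in> borel_subsets S. F \<subseteq> U - K \<longrightarrow> norm (M F) < e))"

definition borel_partition :: "real set \<Rightarrow> real set set \<Rightarrow> bool" where
  "borel_partition S P \<longleftrightarrow> finite P \<and> P \<subseteq> borel_subsets S \<and> \<Union>P = S \<and> disjoint P"

text \<open>Integral of a scalar function f w.r.t. a matrix-valued measure M over S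
  (Dunford--Schwartz integral): I is the limit of the integrals
  \<open>\<Sum>E\<in>P. c E M(E)\<close> of simple functions uniformly approximating f.\<close>
definition has_vm_integral ::
  "(real set \<Rightarrow> complex^'n^'n) \<Rightarrow> real set \<Rightarrow> (real \<Rightarrow> complex) \<Rightarrow> complex^'n^'n \<Rightarrow> bool" where
  "has_vm_integral M S f I \<longleftrightarrow>
     (\<forall>e>0. \<exists>d>0. \<forall>P c. borel_partition S P \<longrightarrow> (\<forall>E\<in>P. \<forall>x\<in>E. cmod (f x - c E) < d) \<longrightarrow>
        norm ((\<Sum>E\<in>P. cscale (c E) (M E)) - I) < e)"

end

theory Submission
  imports Defs "HOL-Probability.Probability" "HOL-Computational_Algebra.Fundamental_Theorem_Algebra"
begin

text \<open>
  Write \<open>1 = (\<Sum>r\<in>S. E r)\<close> with \<open>A E r = r E r\<close>, \<open>S\<close> the spectrum of \<open>A\<close>, and expand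
  \<open>(tA + B)^N\<close> into words in \<open>A\<close> and \<open>B\<close>. Inserting the resolution of the identity, the sum of all
  words with \<open>p\<close> letters \<open>A\<close> and \<open>k\<close> letters \<open>B\<close> becomes the sum of
  \<open>h\<^sub>p(l\<^sub>0,\<dots>,l\<^sub>k) E l\<^sub>0 B E l\<^sub>1 B \<dots> B E l\<^sub>k\<close> over \<open>l\<^sub>0,\<dots>,l\<^sub>k \<in> S\<close>, where \<open>h\<^sub>p\<close> is the complete
  homogeneous symmetric polynomial. Now \<open>h\<^sub>p(l\<^sub>0,\<dots>,l\<^sub>k) p! k! / (p+k)!\<close> is the \<open>p\<close>-th moment of the law
  \<open>\<nu>\<close> of \<open>s\<^sub>0 l\<^sub>0 + \<dots> + s\<^sub>k l\<^sub>k\<close> for a uniformly distributed point \<open>s\<close> of the standard simplex, so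
  that \<open>exp (tA + B)\<close> is the sum of \<open>(1/k!) E l\<^sub>0 B \<dots> B E l\<^sub>k\<close> times the Laplace transform of \<open>\<nu>\<close>, and
  \<open>M\<close> is the same superposition of the probability measures \<open>\<nu>\<close>, which live on the convex hull of \<open>S\<close>.
\<close>

subsection \<open>Matrix algebra\<close>

lemma norm_cscale: "norm (cscale c X) = cmod c * norm X"
proof -
  have "norm (cscale c X $ i) = cmod c * norm (X $ i)" for i
    by (simp add: norm_vec_def cscale_def norm_mult L2_set_right_distrib)
  then show ?thesis
    by (simp add: norm_vec_def[of "cscale c X"] norm_vec_def[of X] L2_set_right_distrib)
qed

lemma bounded_bilinear_cscale: "bounded_bilinear cscale"
proof
  show "\<exists>K. \<forall>a b. norm (cscale a b) \<le> norm a * norm b * K"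
    by (rule exI[of _ 1]) (simp add: norm_cscale)
qed (auto simp: cscale_def vec_eq_iff algebra_simps)

lemmas bounded_linear_cscale_right = bounded_bilinear.bounded_linear_right[OF bounded_bilinear_cscale]
lemmas bounded_linear_cscale_left = bounded_bilinear.bounded_linear_left[OF bounded_bilinear_cscale]

lemma cscale_scaleR: "cscale c (r *\<^sub>R X) = cscale (c * of_real r) X"
  by (simp add: cscale_def vec_eq_iff) (simp add: scaleR_conv_of_real mult.assoc)

lemma cscale_mult_left: "cscale c X ** Y = cscale c (X ** Y)"
  by (simp add: cscale_def matrix_matrix_mult_def vec_eq_iff sum_distrib_left mult_ac)

lemma cscale_mult_right: "X ** cscale c Y = cscale c (X ** Y)"
  by (simp add: cscale_def matrix_matrix_mult_def vec_eq_iff sum_distrib_left mult_ac)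

lemma cscale_cscale: "cscale c (cscale d X) = cscale (c * d) X"
  by (simp add: cscale_def vec_eq_iff)

lemma cscale_1 [simp]: "cscale 1 X = X"
  by (simp add: cscale_def vec_eq_iff)

lemma cscale_0 [simp]: "cscale 0 X = 0" "cscale c 0 = 0"
  by (simp_all add: cscale_def vec_eq_iff)

text \<open>Turns real scaling into \<open>cscale\<close>, so that one set of rules serves
  both.\<close>

lemma scaleR_eq_cscale: "r *\<^sub>R X = cscale (of_real r) X"
  by (simp add: cscale_def vec_eq_iff) (simp add: scaleR_conv_of_real)

lemma matrix_add_rdistrib: "(X + Y) ** Z = X ** Z + Y ** (Z :: complex^'n^'n)"
  by (simp add: matrix_matrix_mult_def vec_eq_iff distrib_right sum.distrib)

lemma bounded_bilinear_matrix_mult: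
  "bounded_bilinear ((**) :: complex^'n^'n \<Rightarrow> complex^'n^'n \<Rightarrow> complex^'n^'n)"
  unfolding bilinear_conv_bounded_bilinear[symmetric] bilinear_def
  by (auto intro!: linearI simp: matrix_add_ldistrib matrix_add_rdistrib scaleR_eq_cscale
        cscale_mult_left cscale_mult_right)

lemmas matrix_mult_sum_right = bounded_bilinear.sum_right[OF bounded_bilinear_matrix_mult]
lemmas matrix_mult_sum_left = bounded_bilinear.sum_left[OF bounded_bilinear_matrix_mult]
lemmas matrix_mult_diff_right = bounded_bilinear.diff_right[OF bounded_bilinear_matrix_mult]
lemmas cscale_add_left = bounded_bilinear.add_left[OF bounded_bilinear_cscale]
lemmas cscale_add_right = bounded_bilinear.add_right[OF bounded_bilinear_cscale]
lemmas cscale_diff_left = bounded_bilinear.diff_left[OF bounded_bilinear_cscale]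
lemmas cscale_diff_right = bounded_bilinear.diff_right[OF bounded_bilinear_cscale]
lemmas cscale_sum_right = bounded_bilinear.sum_right[OF bounded_bilinear_cscale]

section \<open>Conjugate transposes and Hermitian parts\<close>

definition adjoint_mat :: "complex^'n^'n \<Rightarrow> complex^'n^'n"
  where "adjoint_mat X = (\<chi> i j. cnj (X $ j $ i))"

lemma hermitian_iff_adjoint: "hermitian X \<longleftrightarrow> adjoint_mat X = X"
proof -
  have "hermitian X \<longleftrightarrow> X = adjoint_mat X"
    by (simp only: hermitian_def adjoint_mat_def vec_eq_iff vec_lambda_beta)
  then show ?thesis by (simp only: eq_commute[of X])
qed

lemma adjoint_mat_mult: "adjoint_mat (X ** Y) = adjoint_mat Y ** adjoint_mat X"
  by (simp add: adjoint_mat_def matrix_matrix_mult_def vec_eq_iff mult.commute)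

lemma adjoint_mat_cscale: "adjoint_mat (cscale c X) = cscale (cnj c) (adjoint_mat X)"
  by (simp add: adjoint_mat_def cscale_def vec_eq_iff)

lemma adjoint_mat_diff: "adjoint_mat (X - Y) = adjoint_mat X - adjoint_mat Y"
  by (simp add: adjoint_mat_def vec_eq_iff)

text \<open>The diagonal entry of \<open>adjoint_mat X ** X\<close> at i is the sum of the squared
  moduli in column i of X. This definiteness drives both facts on Hermitian matrices used in the
  spectral resolution.\<close>

lemma adjoint_mat_self_mult_eq_0: "adjoint_mat X ** X = 0 \<longleftrightarrow> X = 0"
proof
  assume X: "adjoint_mat X ** X = 0"
  have "X $ k $ i = 0" for k i
  proof -
    have "of_real (\<Sum>k\<in>UNIV. (cmod (X $ k $ i))\<^sup>2) = (adjoint_mat X ** X) $ i $ i"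
      by (simp only: of_real_sum complex_norm_square) (simp add: adjoint_mat_def matrix_matrix_mult_def mult.commute)
    also have "\<dots> = of_real 0" using X by simp
    finally have "(\<Sum>k\<in>UNIV. (cmod (X $ k $ i))\<^sup>2) = 0" by (simp only: of_real_eq_iff)
    then show ?thesis by (simp add: sum_nonneg_eq_0_iff)
  qed
  then show "X = 0" by (simp add: vec_eq_iff)
qed simp

lemma bounded_linear_adjoint_mat: "bounded_linear (adjoint_mat :: complex^'n^'n \<Rightarrow> _)"
  unfolding linear_conv_bounded_linear[symmetric]
  by (intro linearI) (simp_all add: adjoint_mat_def vec_eq_iff)

lemma mpow_comm: "X ** mpow X k = mpow X k ** X"
proof (induction k)
  case (Suc k)
  have "X ** mpow X (Suc k) = X ** (mpow X k ** X)" by (simp add: Suc.IH)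
  then show ?case by (simp add: matrix_mul_assoc)
qed simp

lemma adjoint_mat_one: "adjoint_mat (mat 1) = mat 1"
  by (simp add: adjoint_mat_def mat_def vec_eq_iff)

lemma adjoint_mat_mpow: "adjoint_mat (mpow X k) = mpow (adjoint_mat X) k"
proof (induction k)
  case (Suc k)
  have "adjoint_mat (mpow X (Suc k)) = mpow (adjoint_mat X) k ** adjoint_mat X"
    by (simp add: adjoint_mat_mult Suc.IH)
  then show ?case by (simp add: mpow_comm)
qed (simp add: adjoint_mat_one)

text \<open>\<open>mexp\<close> is a bare \<open>suminf\<close>, so convergence is assumed here; for
  the matrices tA + B it comes out of \<open>mexp_eq_superposition\<close>.\<close>

lemma adjoint_mat_mexp:
  assumes "(\<lambda>N. (1 / fact N) *\<^sub>R mpow X N) sums mexp X"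
  shows "adjoint_mat (mexp X) = mexp (adjoint_mat X)"
proof -
  have "(\<lambda>N. adjoint_mat ((1 / fact N) *\<^sub>R mpow X N)) sums adjoint_mat (mexp X)"
    by (rule bounded_linear.sums[OF bounded_linear_adjoint_mat assms])
  then have "(\<lambda>N. (1 / fact N) *\<^sub>R mpow (adjoint_mat X) N) sums adjoint_mat (mexp X)"
    by (simp only: linear_cmul[OF bounded_linear.linear[OF bounded_linear_adjoint_mat]] adjoint_mat_mpow)
  then show ?thesis unfolding mexp_def[of "adjoint_mat X"] by (rule sums_unique)
qed

text \<open>A product E l0 B E l1 B ... B E lk need not be Hermitian even for Hermitian A and B.
  Passing to Hermitian parts of the coefficients is what makes the measure Hermitian in that
  case.\<close>

definition herm_part :: "complex^'n^'n \<Rightarrow> complex^'n^'n"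
  where "herm_part X = (1 / 2) *\<^sub>R (X + adjoint_mat X)"

lemma bounded_linear_herm_part: "bounded_linear herm_part"
  unfolding herm_part_def
  by (intro bounded_linear_scaleR_right[THEN bounded_linear_compose] bounded_linear_add
        bounded_linear_ident bounded_linear_adjoint_mat)

lemma adjoint_mat_adjoint_mat [simp]: "adjoint_mat (adjoint_mat X) = X"
  by (simp add: adjoint_mat_def vec_eq_iff)

lemma adjoint_mat_add: "adjoint_mat (X + Y) = adjoint_mat X + adjoint_mat Y"
  by (simp add: adjoint_mat_def vec_eq_iff)

lemma hermitian_herm_part: "hermitian (herm_part X)"
  by (simp add: hermitian_iff_adjoint herm_part_def scaleR_eq_cscale adjoint_mat_cscale adjoint_mat_add add.commute)

subsection \<open>Spectral resolution\<close>

text \<open>Horner evaluation at a matrix, in the form that matches induction over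
  \<open>pCons\<close>.\<close>

definition mpoly :: "complex poly \<Rightarrow> complex^'n^'n \<Rightarrow> complex^'n^'n"
  where "mpoly p A = fold_coeffs (\<lambda>a Y. cscale a (mat 1) + A ** Y) p 0"

lemma mpoly_0 [simp]: "mpoly 0 A = 0"
  by (simp add: mpoly_def)

lemma mpoly_pCons [simp]: "mpoly (pCons a p) A = cscale a (mat 1) + A ** mpoly p A"
  by (cases "p = 0 \<and> a = 0") (auto simp: mpoly_def)

lemma mpoly_add: "mpoly (p + q) A = mpoly p A + mpoly q A"
  by (induction p q rule: poly_induct2) (simp_all add: cscale_add_left matrix_add_ldistrib)

lemma mpoly_smult: "mpoly (smult c p) A = cscale c (mpoly p A)"
  by (induction p) (simp_all add: cscale_add_right cscale_cscale cscale_mult_right)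

lemma mpoly_linear_factor: "mpoly ([:- z, 1:] * q) A = A ** mpoly q A - cscale z (mpoly q A)"
proof -
  have "[:- z, 1:] * q = pCons 0 q + smult (- z) q" by (simp add: add.commute)
  then show ?thesis
    by (simp only: mpoly_add mpoly_pCons mpoly_smult)
       (simp add: bounded_bilinear.minus_left[OF bounded_bilinear_cscale])
qed

lemma mpow_eq_mpoly_monom: "mpow A k = mpoly (monom 1 k) A"
  by (induction k) (simp_all add: monom_0 monom_Suc)

lemma mpoly_sum: "mpoly (sum f K) A = (\<Sum>k\<in>K. mpoly (f k) A)"
  by (induction K rule: infinite_finite_induct) (simp_all add: mpoly_add)

text \<open>With N the real dimension of the matrix space, the N + 1 powers up to exponent N are
  linearly dependent, and a dependence is such a polynomial.\<close>

lemma ex_annihilating_poly: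
  fixes A :: "complex^'n^'n"
  shows "\<exists>p. p \<noteq> 0 \<and> mpoly p A = 0"
proof -
  define N where "N = DIM(complex^'n^'n)"
  have "\<exists>u. (\<exists>k\<in>{..N}. u k \<noteq> 0) \<and> (\<Sum>k\<le>N. u k *\<^sub>R mpow A k) = 0"
  \<comment> \<open>\<open>dependent\<close> speaks of the set of powers, where repeated powers
    count once; a repetition is treated apart and is itself a linear relation.\<close>
  proof (cases "inj_on (mpow A) {..N}")
    case True
    have "card (mpow A ` {..N}) = Suc N" using card_image[OF True] by simp
    then have "DIM(complex^'n^'n) < card (mpow A ` {..N})" using N_def by linarith
    then have "dependent (mpow A ` {..N})" by (intro dependent_biggerset)
    then obtain u where u: "\<exists>v\<in>mpow A ` {..N}. u v \<noteq> 0" "(\<Sum>v\<in>mpow A ` {..N}. u v *\<^sub>R v) = 0"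
      by (subst (asm) dependent_finite) auto
    then show ?thesis
      by (intro exI[of _ "u \<circ> mpow A"]) (auto simp: sum.reindex[OF True])
  next
    case False
    then obtain i j where ij: "i \<le> N" "j \<le> N" "i \<noteq> j" "mpow A i = mpow A j"
      by (auto simp: inj_on_def)
    have "(\<Sum>k\<le>N. ((if k = i then 1 else 0) - (if k = j then 1 else 0)) *\<^sub>R mpow A k) = mpow A i - mpow A j"
      using ij by (simp add: scaleR_diff_left sum_subtractf if_distrib[of "\<lambda>x. x *\<^sub>R _"] cong: if_cong)
    then show ?thesis using ij
      by (intro exI[of _ "\<lambda>k. (if k = i then 1 else 0) - (if k = j then 1 else 0)"]) auto
  qed
  then obtain u k where u: "k \<le> N" "u k \<noteq> 0" "(\<Sum>k\<le>N. u k *\<^sub>R mpow A k) = 0" by auto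
  define p where "p = (\<Sum>k\<le>N. monom (complex_of_real (u k)) k)"
  have "coeff p k = of_real (u k)"
    using u(1) by (simp add: p_def coeff_sum)
  then have "p \<noteq> 0" using u by auto
  moreover have "mpoly p A = (\<Sum>k\<le>N. u k *\<^sub>R mpow A k)"
    unfolding p_def mpoly_sum
    by (simp add: mpow_eq_mpoly_monom scaleR_eq_cscale smult_monom flip: mpoly_smult)
  ultimately show ?thesis using u by auto
qed

text \<open>With Y = (A - r) X, moving the Hermitian factor A - r across the product turns
  \<open>adjoint_mat Y ** Y\<close> into \<open>adjoint_mat X\<close> times (A - r) Y, which is 0;
  definiteness gives Y = 0.\<close>

lemma hermitian_square_kernel:
  assumes "hermitian A" and Y: "Y = A ** X - cscale (of_real r) X"
    and "A ** Y = cscale (of_real r) Y"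
  shows "Y = 0"
proof -
  have adjA: "adjoint_mat A = A" using assms(1) by (simp add: hermitian_iff_adjoint)
  have "adjoint_mat Y ** Y = adjoint_mat X ** (A ** Y) - cscale (of_real r) (adjoint_mat X ** Y)"
    unfolding Y adjoint_mat_diff adjoint_mat_mult adjoint_mat_cscale adjA
    by (simp add: bounded_bilinear.diff_left[OF bounded_bilinear_matrix_mult] cscale_mult_left matrix_mul_assoc)
  also have "\<dots> = 0" by (simp add: assms(3) cscale_mult_right)
  finally show ?thesis by (simp add: adjoint_mat_self_mult_eq_0)
qed

text \<open>The usual argument for eigenvectors, run for all columns of X at once:
  \<open>adjoint_mat X ** A ** X\<close> is both z and \<open>cnj z\<close> times the nonzero matrix
  \<open>adjoint_mat X ** X\<close>.\<close>

lemma hermitian_eigen_real: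
  assumes "hermitian A" "A ** X = cscale z X" "X \<noteq> 0"
  shows "z \<in> \<real>"
proof -
  have adjA: "adjoint_mat A = A" using assms(1) by (simp add: hermitian_iff_adjoint)
  have "cscale z (adjoint_mat X ** X) = adjoint_mat X ** (A ** X)"
    by (simp add: assms(2) cscale_mult_right)
  also have "\<dots> = adjoint_mat (A ** X) ** X"
    by (simp add: adjoint_mat_mult adjA matrix_mul_assoc)
  also have "\<dots> = cscale (cnj z) (adjoint_mat X ** X)"
    by (simp add: assms(2) adjoint_mat_cscale cscale_mult_left)
  finally have "cscale (z - cnj z) (adjoint_mat X ** X) = 0"
    by (simp add: cscale_diff_left)
  then have "norm (cscale (z - cnj z) (adjoint_mat X ** X)) = 0" by simp
  then have "z = cnj z" using assms(3) by (simp add: norm_cscale adjoint_mat_self_mult_eq_0)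
  then show ?thesis by (simp add: complex_is_Real_iff complex_eq_iff)
qed

text \<open>Over a linear factor \<open>A - z\<close> one solves \<open>(A - z) X = Y\<close> eigencomponent by
  eigencomponent; the component at \<open>z\<close> itself is harmless because
  \<open>ker (A - z)\<^sup>2 = ker (A - z)\<close>.\<close>

lemma eigen_decomposition:
  assumes "hermitian A" "p \<noteq> 0" "mpoly p A ** X = 0"
  shows "\<exists>(S :: complex set) E. finite S \<and> (\<forall>z\<in>S. A ** E z = cscale z (E z)) \<and> (\<Sum>z\<in>S. E z) = X"
  using assms(2,3)
proof (induction "degree p" arbitrary: p X)
  case 0
  then obtain a where p: "p = [:a:]" "a \<noteq> 0" by (metis degree_eq_zeroE pCons_eq_0_iff)
  then have "cscale a X = 0" using 0 by (simp add: cscale_mult_left)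
  then have "norm (cscale a X) = 0" by simp
  then have "X = 0" using p by (simp add: norm_cscale)
  then show ?case by (intro exI[of _ "{}"]) auto
next
  case (Suc d)
  obtain z where "poly p z = 0"
    using alg_closed_imp_poly_has_root[of p] Suc.hyps by auto
  then obtain q where p: "p = [:- z, 1:] * q" by (metis poly_eq_0_iff_dvd dvdE)
  have q: "q \<noteq> 0" using p Suc by auto
  have comm: "mpoly q A ** A = A ** mpoly q A"
    by (induction q) (simp_all add: matrix_add_ldistrib matrix_add_rdistrib cscale_mult_left cscale_mult_right
        flip: matrix_mul_assoc)
  \<comment> \<open>Y is annihilated by the quotient q, whose degree is one less, so the induction
    hypothesis decomposes Y instead of X.\<close>
  define Y where "Y = A ** X - cscale z X"
  have dq: "d = degree q" using p Suc.hyps(2) q by (simp add: degree_mult_eq del: mult_pCons_left)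
  have "mpoly q A ** Y = mpoly p A ** X"
    unfolding p mpoly_linear_factor Y_def
    by (simp add: matrix_mult_diff_right bounded_bilinear.diff_left[OF bounded_bilinear_matrix_mult]
        matrix_mul_assoc comm cscale_mult_left cscale_mult_right)
  then have "mpoly q A ** Y = 0" using Suc.prems(2) by simp
  from Suc.hyps(1)[OF dq q this] obtain S :: "complex set" and E where S: "finite S"
    and E: "\<And>w. w \<in> S \<Longrightarrow> A ** E w = cscale w (E w)" and sum: "(\<Sum>w\<in>S. E w) = Y"
    by blast
  \<comment> \<open>\<open>E' w\<close> solves (A - z) \<open>E' w\<close> = \<open>E w\<close> for
    w different from z. At w = z the division yields 0; that index is left out of \<open>X'\<close>,
    and \<open>X'\<close> itself becomes the component there.\<close>
  define E' where "E' w = cscale (1 / (w - z)) (E w)" for w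
  define X' where "X' = X - (\<Sum>w\<in>S-{z}. E' w)"
  have E': "A ** E' w = cscale w (E' w)" if "w \<in> S" for w
    by (simp add: E'_def cscale_mult_right E[OF that] cscale_cscale mult.commute)
  have E'_diff: "A ** E' w - cscale z (E' w) = E w" if "w \<in> S - {z}" for w
  proof -
    have "A ** E' w - cscale z (E' w) = cscale (w - z) (E' w)"
      using E' that by (simp add: cscale_diff_left)
    also have "\<dots> = E w" using that by (simp add: E'_def cscale_cscale)
    finally show ?thesis .
  qed
  define W where "W = A ** X' - cscale z X'"
  have "W = Y - (\<Sum>w\<in>S-{z}. E w)"
  proof -
    have "W = Y - (\<Sum>w\<in>S-{z}. A ** E' w - cscale z (E' w))"
      unfolding W_def X'_def Y_def
      by (simp add: matrix_mult_diff_right cscale_diff_right matrix_mult_sum_right cscale_sum_right sum_subtractf)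
    then show ?thesis using E'_diff by simp
  qed
  also have "\<dots> = (if z \<in> S then E z else 0)"
    unfolding sum[symmetric] using S by (simp add: sum_diff1)
  finally have W: "A ** W = cscale z W" using E by auto
  \<comment> \<open>W is what (A - z) makes of the remainder \<open>X'\<close>, and A - z kills it
    in turn. If W were nonzero, z would be real and \<open>hermitian_square_kernel\<close> would
    apply.\<close>
  have "W = 0"
  proof (rule ccontr)
    assume "W \<noteq> 0"
    then have "z \<in> \<real>" using hermitian_eigen_real[OF assms(1) W] by simp
    then obtain r where "z = of_real r" by (auto elim: Reals_cases)
    then show False using hermitian_square_kernel[OF assms(1), of W X' r] W W_def \<open>W \<noteq> 0\<close> by simp
  qed
  then have X': "A ** X' = cscale z X'" by (simp add: W_def)
  show ?case
  proof (intro exI conjI ballI)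
    show "finite (insert z S)" using S by simp
    show "A ** (E'(z := X')) w = cscale w ((E'(z := X')) w)" if "w \<in> insert z S" for w
      using that X' E' by auto
    have "(\<Sum>w\<in>insert z S. (E'(z := X')) w) = X' + (\<Sum>w\<in>S - {z}. (E'(z := X')) w)"
      using S by (simp add: sum.insert_remove)
    also have "(\<Sum>w\<in>S - {z}. (E'(z := X')) w) = (\<Sum>w\<in>S - {z}. E' w)"
      by (intro sum.cong) auto
    finally show "(\<Sum>w\<in>insert z S. (E'(z := X')) w) = X" by (simp add: X'_def)
  qed
qed

text \<open>The identity matrix is decomposed by means of an annihilating polynomial. Zero
  components are discarded, since a nonzero column of \<open>E r\<close> is the eigenvector for
  r.\<close>

lemma hermitian_spectral_resolution:
  fixes A :: "complex^'n^'n"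
  assumes "hermitian A"
  shows "\<exists>(S :: real set) E. finite S \<and> (\<forall>r\<in>S. is_eigenvalue A (of_real r)) \<and>
    (\<forall>r\<in>S. A ** E r = r *\<^sub>R E r) \<and> (\<Sum>r\<in>S. E r) = mat 1"
proof -
  obtain p where p: "p \<noteq> 0" "mpoly p A = 0" using ex_annihilating_poly by blast
  obtain S :: "complex set" and E where S: "finite S" and E: "\<And>z. z \<in> S \<Longrightarrow> A ** E z = cscale z (E z)"
    and sum: "(\<Sum>z\<in>S. E z) = mat 1"
    using eigen_decomposition[OF assms p(1), of "mat 1"] unfolding p(2) by (metis (no_types) matrix_mul_rid)
  define S' where "S' = {z\<in>S. E z \<noteq> 0}"
  have real: "of_real (Re z) = z" if "z \<in> S'" for z
  proof -
    have z: "z \<in> S" "E z \<noteq> 0" using that by (simp_all add: S'_def)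
    show ?thesis by (rule of_real_Re) (rule hermitian_eigen_real[OF assms E[OF z(1)] z(2)])
  qed
  have inj: "inj_on Re S'" by (rule inj_on_inverseI[of _ of_real]) (simp add: real)
  show ?thesis
  proof (intro exI conjI ballI)
    show "finite (Re ` S')" using S by (simp add: S'_def)
    fix r assume "r \<in> Re ` S'"
    then obtain z where "z \<in> S'" "r = Re z" by blast
    then have "complex_of_real r \<in> S'" using real by simp
    then have r: "complex_of_real r \<in> S" and nz: "E (of_real r) \<noteq> 0" by (simp_all add: S'_def)
    note eq = E[OF r]
    show "A ** (E \<circ> of_real) r = r *\<^sub>R (E \<circ> of_real) r" using eq by (simp add: scaleR_eq_cscale)
    obtain i j where ij: "E (of_real r) $ i $ j \<noteq> 0" using nz by (auto simp: vec_eq_iff)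
    define v where "v = column j (E (of_real r))"
    have "v \<noteq> 0" using ij by (auto simp: v_def column_def vec_eq_iff)
    moreover have "A *v v = of_real r *s v"
    proof -
      have "(A *v v) $ i = (A ** E (of_real r)) $ i $ j" for i
        by (simp add: v_def column_def matrix_matrix_mult_def matrix_vector_mult_def)
      then show ?thesis unfolding eq by (simp add: v_def column_def cscale_def vec_eq_iff)
    qed
    ultimately show "is_eigenvalue A (of_real r)" by (auto simp: is_eigenvalue_def)
  next
    have "(\<Sum>r\<in>Re ` S'. (E \<circ> of_real) r) = (\<Sum>z\<in>S'. E z)"
      by (simp add: sum.reindex[OF inj] real)
    also have "\<dots> = (\<Sum>z\<in>S. E z)" using S by (intro sum.mono_neutral_left) (auto simp: S'_def)
    finally show "(\<Sum>r\<in>Re ` S'. (E \<circ> of_real) r) = mat 1" using sum by simp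
  qed
qed

subsection \<open>Words in two matrices\<close>

text \<open>Complete homogeneous symmetric polynomials; monomials are sorted by whether the first
  variable occurs.\<close>

fun hsym :: "nat \<Rightarrow> 'a::comm_semiring_1 list \<Rightarrow> 'a" where
  "hsym 0 ls = 1"
| "hsym (Suc p) [] = 0"
| "hsym (Suc p) (l # ls) = l * hsym p (l # ls) + hsym (Suc p) ls"

lemma hsym_singleton: "hsym p [l] = l ^ p"
  by (induction p) auto

text \<open>The sum of all words with p letters A and k letters B, sorted by the first
  letter.\<close>

fun word_sum :: "complex^'n^'n \<Rightarrow> complex^'n^'n \<Rightarrow> nat \<Rightarrow> nat \<Rightarrow> complex^'n^'n" where
  "word_sum A B 0 0 = mat 1"
| "word_sum A B (Suc p) 0 = A ** word_sum A B p 0"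
| "word_sum A B 0 (Suc k) = B ** word_sum A B 0 k"
| "word_sum A B (Suc p) (Suc k) = A ** word_sum A B p (Suc k) + B ** word_sum A B (Suc p) k"

lemma mpow_affine:
  "mpow (cscale t A + B) N = (\<Sum>k\<le>N. cscale (t ^ (N - k)) (word_sum A B (N - k) k))"
proof (induction N)
  case (Suc N)
  define a where "a k = cscale (t ^ (Suc N - k)) (A ** word_sum A B (N - k) k)" for k
  define b where "b k = cscale (t ^ (N - k)) (B ** word_sum A B (N - k) k)" for k
  \<comment> \<open>Words starting with A are absent for k = N + 1, words starting with B are absent
    for k = 0 and leave a rest with k - 1 letters B.\<close>
  have split: "cscale (t ^ (Suc N - k)) (word_sum A B (Suc N - k) k)
      = (if k \<le> N then a k else 0) + (if k = 0 then 0 else b (k - 1))" if "k \<le> Suc N" for k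
  proof (cases k)
    case 0
    then show ?thesis by (simp add: a_def)
  next
    case (Suc k')
    show ?thesis
    proof (cases "k' = N")
      case True
      then show ?thesis using Suc by (simp add: b_def)
    next
      case False
      then have "Suc N - k = Suc (N - k)" "N - k' = Suc (N - k)" using Suc that by auto
      then show ?thesis using Suc that False by (simp add: a_def b_def cscale_add_right)
    qed
  qed
  have "mpow (cscale t A + B) (Suc N)
      = (\<Sum>k\<le>N. cscale t A ** cscale (t ^ (N - k)) (word_sum A B (N - k) k))
        + (\<Sum>k\<le>N. B ** cscale (t ^ (N - k)) (word_sum A B (N - k) k))"
    by (simp add: Suc.IH matrix_add_rdistrib matrix_mult_sum_right sum.distrib)
  also have "\<dots> = (\<Sum>k\<le>N. a k) + (\<Sum>k\<le>N. b k)"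
    by (intro arg_cong2[of _ _ _ _ "(+)"] sum.cong)
       (auto simp: a_def b_def cscale_mult_left cscale_mult_right cscale_cscale Suc_diff_le mult.commute)
  also have "(\<Sum>k\<le>N. a k) = (\<Sum>k\<le>Suc N. if k \<le> N then a k else 0)"
    by simp
  also have "(\<Sum>k\<le>N. b k) = (\<Sum>k\<le>Suc N. if k = 0 then 0 else b (k - 1))"
    by (subst sum.atMost_Suc_shift) simp
  also have "(\<Sum>k\<le>Suc N. if k \<le> N then a k else 0) + (\<Sum>k\<le>Suc N. if k = 0 then 0 else b (k - 1))
      = (\<Sum>k\<le>Suc N. cscale (t ^ (Suc N - k)) (word_sum A B (Suc N - k) k))"
    unfolding sum.distrib[symmetric] by (intro sum.cong refl) (simp only: split atMost_iff)
  finally show ?case .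
qed simp

definition lists_of_length :: "'a set \<Rightarrow> nat \<Rightarrow> 'a list set"
  where "lists_of_length S n = {ls. set ls \<subseteq> S \<and> length ls = n}"

lemma finite_lists_of_length: "finite S \<Longrightarrow> finite (lists_of_length S n)"
  unfolding lists_of_length_def by (rule finite_lists_length_eq)

lemma card_lists_of_length: "finite S \<Longrightarrow> card (lists_of_length S n) = card S ^ n"
  unfolding lists_of_length_def by (rule card_lists_length_eq)

lemma lists_of_length_0: "lists_of_length S 0 = {[]}"
  by (auto simp: lists_of_length_def)

lemma sum_lists_of_length_Suc:
  "(\<Sum>ls\<in>lists_of_length S (Suc n). f ls) = (\<Sum>l\<in>S. \<Sum>ls\<in>lists_of_length S n. f (l # ls))"
proof -
  have "lists_of_length S (Suc n) = (\<lambda>(l, ls). l # ls) ` (S \<times> lists_of_length S n)"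
    by (auto simp: lists_of_length_def image_def length_Suc_conv)
  moreover have "inj_on (\<lambda>(l, ls). l # ls) (S \<times> lists_of_length S n)"
    by (auto simp: inj_on_def)
  ultimately show ?thesis
    by (simp add: sum.reindex sum.cartesian_product case_prod_beta')
qed

text \<open>The product E l0 B E l1 B ... B E lk; the test for an empty tail prevents a trailing
  B.\<close>

fun word_coeff :: "(real \<Rightarrow> complex^'n^'n) \<Rightarrow> complex^'n^'n \<Rightarrow> real list \<Rightarrow> complex^'n^'n" where
  "word_coeff E B [] = mat 1"
| "word_coeff E B (l # ls) = E l ** (if ls = [] then mat 1 else B ** word_coeff E B ls)"

text \<open>The recursions of \<open>word_sum\<close> and \<open>hsym\<close> agree: a leading A
  multiplies by the first eigenvalue and keeps the list, a leading B extends the list and keeps the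
  weight.\<close>

lemma word_sum_eigen_expansion:
  fixes A B :: "complex^'n^'n"
  assumes eig: "\<And>r. r \<in> S \<Longrightarrow> A ** E r = r *\<^sub>R E r" and one: "(\<Sum>r\<in>S. E r) = mat 1"
  shows "word_sum A B p k = (\<Sum>ls\<in>lists_of_length S (Suc k). hsym p ls *\<^sub>R word_coeff E B ls)"
proof -
  let ?L = "lists_of_length S" and ?c = "word_coeff E B"
  have A_coeff: "A ** ?c (l # ls) = l *\<^sub>R ?c (l # ls)" if "l \<in> S" for l ls
    using eig[OF that] by (simp add: matrix_mul_assoc scaleR_eq_cscale cscale_mult_left)
  have A_sum: "A ** (\<Sum>ls\<in>?L (Suc k). hsym p ls *\<^sub>R ?c ls)
      = (\<Sum>l\<in>S. \<Sum>ls\<in>?L k. (l * hsym p (l # ls)) *\<^sub>R ?c (l # ls))" for p k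
    unfolding sum_lists_of_length_Suc matrix_mult_sum_right
    by (intro sum.cong refl)
       (simp add: bounded_bilinear.scaleR_right[OF bounded_bilinear_matrix_mult] A_coeff mult.commute
          del: word_coeff.simps)
  \<comment> \<open>The identity is inserted to the left of B as the sum of the \<open>E l\<close>,
    which puts a new eigenvalue l in front of each list.\<close>
  have B_sum: "B ** (\<Sum>ls\<in>?L (Suc k). hsym p ls *\<^sub>R ?c ls)
      = (\<Sum>l\<in>S. \<Sum>ls\<in>?L (Suc k). hsym p ls *\<^sub>R ?c (l # ls))" for p k
  proof -
    define Z where "Z = (\<Sum>ls\<in>?L (Suc k). hsym p ls *\<^sub>R ?c ls)"
    have "(\<Sum>ls\<in>?L (Suc k). hsym p ls *\<^sub>R ?c (l # ls)) = E l ** (B ** Z)" for l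
      unfolding Z_def matrix_mult_sum_right
      by (intro sum.cong refl)
         (auto simp: bounded_bilinear.scaleR_right[OF bounded_bilinear_matrix_mult] lists_of_length_def)
    then have "(\<Sum>l\<in>S. \<Sum>ls\<in>?L (Suc k). hsym p ls *\<^sub>R ?c (l # ls)) = (\<Sum>l\<in>S. E l) ** (B ** Z)"
      by (simp add: matrix_mult_sum_left)
    then show ?thesis by (simp add: one Z_def)
  qed
  show ?thesis
  proof (induction p arbitrary: k)
    case 0
    show ?case
    proof (induction k)
      case 0
      show ?case by (simp add: sum_lists_of_length_Suc[of _ _ 0, unfolded One_nat_def] lists_of_length_0 one)
    next
      case (Suc k)
      show ?case by (simp only: word_sum.simps Suc.IH B_sum)
          (simp add: sum_lists_of_length_Suc[of _ _ "Suc k"] del: word_coeff.simps)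
    qed
  next
    case (Suc p)
    note IHp = Suc.IH
    show ?case
    proof (induction k)
      case 0
      show ?case by (simp only: word_sum.simps IHp A_sum) (simp add: sum_lists_of_length_Suc[of _ _ 0] lists_of_length_0)
    next
      case (Suc k)
      show ?case
        by (simp only: word_sum.simps Suc.IH IHp A_sum B_sum)
           (simp add: sum_lists_of_length_Suc[of _ _ "Suc k"] scaleR_add_left sum.distrib del: word_coeff.simps)
    qed
  qed
qed

text \<open>Growth that is only geometric in the length is what the factor 1/k! later
  absorbs.\<close>

lemma word_coeff_bound:
  fixes B :: "complex^'n^'n"
  assumes "finite S"
  obtains K where "K \<ge> 0" "\<And>ls. ls \<noteq> [] \<Longrightarrow> set ls \<subseteq> S \<Longrightarrow> norm (word_coeff E B ls) \<le> K ^ length ls"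
proof -
  have "\<exists>\<kappa>>0. \<forall>(X :: complex^'n^'n) (Y :: complex^'n^'n). norm (X ** Y) \<le> norm X * norm Y * \<kappa>"
    by (rule bounded_bilinear.pos_bounded[OF bounded_bilinear_matrix_mult])
  then obtain \<kappa> where \<kappa>: "\<kappa> > 0" "\<And>(X :: complex^'n^'n) (Y :: complex^'n^'n). norm (X ** Y) \<le> norm X * norm Y * \<kappa>"
    by auto
  define e where "e = (\<Sum>l\<in>S. norm (E l))"
  have e0: "e \<ge> 0" unfolding e_def by (intro sum_nonneg) simp
  have e: "norm (E l) \<le> e" if "l \<in> S" for l
    unfolding e_def using that assms by (intro member_le_sum) auto
  \<comment> \<open>The summand e covers a single \<open>E l\<close>; the other one is the cost of
    prepending \<open>E l\<close> and B, with one factor \<open>\<kappa>\<close> for each of the two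
    products.\<close>
  define K where "K = e * (1 + norm B * \<kappa> * \<kappa>)"
  have K_eq: "K = e + e * (norm B * \<kappa> * \<kappa>)" by (simp add: K_def distrib_left)
  have eK: "e \<le> K" using e0 \<kappa>(1) by (simp add: K_eq)
  have K0: "K \<ge> 0" using e0 eK by linarith
  have "norm (word_coeff E B ls) \<le> K ^ length ls" if "ls \<noteq> []" "set ls \<subseteq> S" for ls
    using that
  proof (induction ls)
    case (Cons l ls)
    show ?case
    proof (cases "ls = []")
      case True
      then show ?thesis using e[of l] eK Cons.prems by simp
    next
      case False
      have "norm (word_coeff E B (l # ls)) \<le> norm (E l) * norm (B ** word_coeff E B ls) * \<kappa>"
        using False \<kappa>(2) by simp
      also have "\<dots> \<le> norm (E l) * (norm B * norm (word_coeff E B ls) * \<kappa>) * \<kappa>"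
        using \<kappa> by (intro mult_right_mono mult_left_mono) auto
      also have "\<dots> \<le> e * (norm B * K ^ length ls * \<kappa>) * \<kappa>"
      proof -
        have "norm (word_coeff E B ls) \<le> K ^ length ls" and "l \<in> S" using Cons False by simp_all
        then show ?thesis using \<kappa>(1) e[of l] e0
          by (intro mult_right_mono mult_mono mult_left_mono mult_nonneg_nonneg) simp_all
      qed
      also have "\<dots> = (e * (norm B * \<kappa> * \<kappa>)) * K ^ length ls" by simp
      also have "\<dots> \<le> K * K ^ length ls"
        using e0 K0 K_eq by (intro mult_right_mono) (linarith, simp)
      finally show ?thesis by simp
    qed
  qed simp
  then show ?thesis using that K0 by blast
qed

subsection \<open>Projections of the uniform distribution on a simplex\<close>

text \<open>The Beta(k, 1) law. For k = 0 the factor \<open>real k\<close> makes it the zero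
  measure, hence the condition k > 0 in what follows.\<close>

definition beta_measure :: "nat \<Rightarrow> real measure"
  where "beta_measure k = density lborel (\<lambda>w. ennreal (indicator {0..1} w * (real k * w ^ (k - 1))))"

lemma sets_beta_measure [simp, measurable_cong]: "sets (beta_measure k) = sets borel"
  by (simp add: beta_measure_def)

lemma AE_beta_measure: "AE w in beta_measure k. w \<in> {0..1}"
  unfolding beta_measure_def by (subst AE_density) (auto simp: indicator_def split: if_splits)

lemma prob_space_beta_measure:
  assumes "k > 0"
  shows "prob_space (beta_measure k)"
proof
  have "emeasure (beta_measure k) (space (beta_measure k))
      = (\<integral>\<^sup>+ w. ennreal (real k * w ^ (k - 1)) * indicator {0..1} w \<partial>lborel)"
    unfolding beta_measure_def by (simp add: emeasure_density) (auto intro!: nn_integral_cong simp: indicator_def)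
  also have "\<dots> = ennreal (1 ^ k - 0 ^ k)"
    by (rule nn_integral_FTC_Icc) (auto intro!: derivative_eq_intros)
  finally show "emeasure (beta_measure k) (space (beta_measure k)) = 1"
    using assms by (simp add: power_0_left)
qed

lemma integral_beta_measure:
  assumes "continuous_on UNIV g"
  shows "(\<integral>w. g w \<partial>beta_measure k) = (\<integral>w. indicator {0..1} w *\<^sub>R (real k * w ^ (k - 1) * g w) \<partial>lborel)"
proof -
  have [measurable]: "g \<in> borel_measurable borel" using assms by (rule borel_measurable_continuous_onI)
  show ?thesis
    unfolding beta_measure_def
    by (subst integral_density) (auto simp: indicator_def intro!: Bochner_Integration.integral_cong)
qed

text \<open>The fundamental theorem of calculus for k w^k (l + w (x - l))^(p+1), which is k x^(p+1)
  at w = 1 and 0 at w = 0.\<close>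

lemma beta_moment_recursion:
  fixes l x :: real and k :: nat
  assumes "k > 0"
  shows "real (Suc p + k) * (\<integral>w. (l + w * (x - l)) ^ Suc p \<partial>beta_measure k)
      = real k * x ^ Suc p + real (Suc p) * l * (\<integral>w. (l + w * (x - l)) ^ p \<partial>beta_measure k)"
proof -
  define J where "J p = (\<integral>w. (l + w * (x - l)) ^ p \<partial>beta_measure k)" for p
  define g where "g w = l + w * (x - l)" for w
  define F where "F w = real k * (w ^ k * g w ^ Suc p)" for w
  define f where "f w = real k * (real (Suc p + k) * w ^ (k-1) * g w ^ Suc p - real (Suc p) * l * (w ^ (k-1) * g w ^ p))" for w
  define j where "j q w = indicator {0..1} w *\<^sub>R (real k * w ^ (k - 1) * g w ^ q)" for q w
  have wk: "w ^ k = w * w ^ (k - 1)" for w :: real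
    using assms(1) by (cases k) auto
  have deriv: "(F has_real_derivative f w) (at w)" for w
  proof -
    have "(F has_real_derivative real k * (real k * w ^ (k - 1) * g w ^ Suc p
             + w ^ k * (real (Suc p) * g w ^ p * (x - l)))) (at w)"
    proof -
      have g: "(g has_real_derivative (x - l)) (at w)"
        unfolding g_def by (auto intro!: derivative_eq_intros)
      show ?thesis
        unfolding F_def
        by (rule DERIV_cong[OF DERIV_cmult[OF DERIV_mult[OF DERIV_pow DERIV_power[OF g]]]])
           (simp add: algebra_simps del: of_nat_Suc)
    qed
    \<comment> \<open>Writing w (x - l) as \<open>g w - l\<close> expresses the derivative through
      the integrands of the two moments.\<close>
    moreover have "w ^ k * (real (Suc p) * g w ^ p * (x - l)) = real (Suc p) * (w ^ (k-1) * g w ^ p * (g w - l))"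
      unfolding wk g_def by (simp add: algebra_simps)
    ultimately have "(F has_real_derivative real k * (real k * w ^ (k - 1) * g w ^ Suc p
             + real (Suc p) * (w ^ (k-1) * g w ^ p * (g w - l)))) (at w)" by (simp only:)
    then show ?thesis by (rule DERIV_cong) (simp add: f_def algebra_simps)
  qed
  have cont: "continuous_on {0..1} f"
    unfolding f_def g_def by (intro continuous_intros)
  have int_f: "(\<integral>w. indicator {0..1} w *\<^sub>R f w \<partial>lborel) = F 1 - F 0"
    by (rule integral_FTC_Icc) (auto intro!: cont DERIV_subset[OF deriv] simp flip: has_real_derivative_iff_has_vector_derivative)
  have J: "J q = (\<integral>w. j q w \<partial>lborel)" for q
    unfolding J_def j_def g_def by (intro integral_beta_measure continuous_intros)
  have intg: "integrable lborel (j q)" for q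
    unfolding j_def g_def by (intro borel_integrable_compact continuous_intros) auto
  have "F 1 - F 0 = real (Suc p + k) * J (Suc p) - real (Suc p) * l * J p"
  proof -
    have "F 1 - F 0 = (\<integral>w. real (Suc p + k) * j (Suc p) w - real (Suc p) * l * j p w \<partial>lborel)"
      unfolding int_f[symmetric] f_def j_def
      by (intro Bochner_Integration.integral_cong) (auto simp: algebra_simps)
    also have "\<dots> = real (Suc p + k) * J (Suc p) - real (Suc p) * l * J p"
      unfolding J using intg by simp
    finally show ?thesis .
  qed
  then show ?thesis using assms(1) by (simp add: F_def g_def J_def power_0_left)
qed

lemma affine_in_interval:
  fixes a b l w x :: real
  assumes "l \<in> {a..b}" "w \<in> {0..1}" "x \<in> {a..b}"
  shows "l + w * (x - l) \<in> {a..b}"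
proof -
  have "(1 - w) *\<^sub>R l + w *\<^sub>R x \<in> {a..b}"
    using convexD_alt[OF convex_real_interval(5)] assms by auto
  then show ?thesis by (simp add: algebra_simps)
qed

text \<open>The law of \<open>s\<^sub>0 l\<^sub>0 + \<dots> + s\<^sub>k l\<^sub>k\<close> for a uniform point \<open>s\<close> of the simplex, built recursively:
  \<open>w = 1 - s\<^sub>0\<close> has density \<open>k w^(k-1)\<close>, and \<open>s\<^sub>1/w, \<dots>, s\<^sub>k/w\<close> is an independent uniform point
  of the simplex one dimension lower.\<close>

lemma simplex_projection_measure:
  fixes ls :: "real list"
  assumes "ls \<noteq> []" "set ls \<subseteq> {a..b}"
  shows "\<exists>\<nu>. prob_space \<nu> \<and> sets \<nu> = sets borel \<and> (AE x in \<nu>. x \<in> {a..b}) \<and>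
     (\<forall>p. (\<integral>x. x ^ p \<partial>\<nu>) * fact (p + (length ls - 1)) = hsym p ls * fact p * fact (length ls - 1))"
  using assms
proof (induction ls)
  case (Cons l ls)
  show ?case
  proof (cases "ls = []")
    case True
    have "(\<integral>x. x ^ p \<partial>return borel l) = l ^ p" for p by (subst integral_return) auto
    moreover have "AE x in return borel l. x \<in> {a..b}" using Cons.prems by (subst AE_return) auto
    ultimately show ?thesis using True
      by (intro exI[of _ "return borel l"]) (auto simp: prob_space_return hsym_singleton)
  next
    case False
    then obtain \<nu> where \<nu>: "prob_space \<nu>" "sets \<nu> = sets borel" "AE x in \<nu>. x \<in> {a..b}"
      and mom: "\<And>p. (\<integral>x. x ^ p \<partial>\<nu>) * fact (p + (length ls - 1)) = hsym p ls * fact p * fact (length ls - 1)"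
      using Cons by auto
    define k where "k = length ls"
    have k: "k > 0" using False by (simp add: k_def)
    interpret X: prob_space \<nu> by fact
    interpret W: prob_space "beta_measure k" using prob_space_beta_measure k .
    interpret WX: pair_prob_space "beta_measure k" \<nu> ..
    \<comment> \<open>This is (1 - w) l + w x, with x distributed as the combination of the tail and
      independent of w.\<close>
    define Y where "Y = (\<lambda>(w, x). l + w * (x - l))"
    have sets_pair: "sets (beta_measure k \<Otimes>\<^sub>M \<nu>) = sets (borel \<Otimes>\<^sub>M borel)"
      by (intro sets_pair_measure_cong sets_beta_measure \<nu>)
    have "Y \<in> borel_measurable (borel \<Otimes>\<^sub>M borel)"
      unfolding Y_def case_prod_beta by measurable
    then have Y_meas [measurable]: "Y \<in> borel_measurable (beta_measure k \<Otimes>\<^sub>M \<nu>)"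
      by (subst measurable_cong_sets[OF sets_pair refl])
    have AE_pair: "AE z in beta_measure k \<Otimes>\<^sub>M \<nu>. fst z \<in> {0..1} \<and> snd z \<in> {a..b}"
    proof (rule WX.AE_pair_measure)
      have "{0..1} \<times> {a..b} \<in> sets (beta_measure k \<Otimes>\<^sub>M \<nu>)"
        unfolding sets_pair by (intro pair_measureI) auto
      also have "{0..1} \<times> {a..b} = {z \<in> space (beta_measure k \<Otimes>\<^sub>M \<nu>). fst z \<in> {0..1} \<and> snd z \<in> {a..b}}"
        using sets_eq_imp_space_eq[OF sets_pair] by (auto simp: space_pair_measure)
      finally show "{z \<in> space (beta_measure k \<Otimes>\<^sub>M \<nu>). fst z \<in> {0..1} \<and> snd z \<in> {a..b}}
          \<in> sets (beta_measure k \<Otimes>\<^sub>M \<nu>)" .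
      show "AE w in beta_measure k. AE x in \<nu>. fst (w, x) \<in> {0..1} \<and> snd (w, x) \<in> {a..b}"
        using AE_beta_measure[of k] by eventually_elim (use \<nu>(3) in auto)
    qed
    have AE_Y: "AE z in beta_measure k \<Otimes>\<^sub>M \<nu>. Y z \<in> {a..b}"
      using AE_pair
    proof eventually_elim
      case (elim z)
      then show ?case using affine_in_interval[of l a b "fst z" "snd z"] Cons.prems
        by (auto simp: Y_def case_prod_beta)
    qed
    define \<mu> where "\<mu> = distr (beta_measure k \<Otimes>\<^sub>M \<nu>) borel Y"
    have prob: "prob_space \<mu>" unfolding \<mu>_def by (rule WX.prob_space_distr) measurable
    have AE: "AE x in \<mu>. x \<in> {a..b}" unfolding \<mu>_def using AE_Y by (subst AE_distr_iff) auto
    define m where "m p = (\<integral>x. x ^ p \<partial>\<mu>)" for p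
    define J where "J p x = (\<integral>w. (l + w * (x - l)) ^ p \<partial>beta_measure k)" for p x
    define c where "c = max \<bar>a\<bar> \<bar>b\<bar>"
    have int_Y: "integrable (beta_measure k \<Otimes>\<^sub>M \<nu>) (\<lambda>z. Y z ^ p)" for p
    proof (rule WX.integrable_const_bound[of _ "c ^ p"])
      show "AE z in beta_measure k \<Otimes>\<^sub>M \<nu>. norm (Y z ^ p) \<le> c ^ p"
        using AE_Y by eventually_elim (auto simp: power_abs c_def intro!: power_mono)
    qed measurable
    have X_meas [measurable]: "(\<lambda>x. x) \<in> borel_measurable \<nu>"
      by (subst measurable_cong_sets[OF \<nu>(2) refl]) simp
    have int_X: "integrable \<nu> (\<lambda>x. x ^ p)" for p
    proof (rule X.integrable_const_bound[of _ "c ^ p"])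
      show "AE x in \<nu>. norm (x ^ p) \<le> c ^ p"
        using \<nu>(3) by eventually_elim (auto simp: power_abs c_def intro!: power_mono)
    qed measurable
    have J_Y: "J p = (\<lambda>x. \<integral>w. Y (w, x) ^ p \<partial>beta_measure k)" for p
      by (simp add: fun_eq_iff J_def Y_def)
    have m_J: "m p = (\<integral>x. J p x \<partial>\<nu>)" for p
    proof -
      have "m p = (\<integral>z. Y z ^ p \<partial>(beta_measure k \<Otimes>\<^sub>M \<nu>))"
        unfolding m_def \<mu>_def by (subst integral_distr) auto
      also have "\<dots> = (\<integral>x. J p x \<partial>\<nu>)"
        using WX.integral_snd[of "\<lambda>w x. Y (w, x) ^ p"] int_Y[of p]
        by (simp add: case_prod_beta' J_Y)
      finally show ?thesis .
    qed
    have int_J: "integrable \<nu> (J p)" for p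
      using WX.integrable_snd[of "\<lambda>w x. Y (w, x) ^ p"] int_Y[of p]
      by (simp add: case_prod_beta' J_Y)
    \<comment> \<open>\<open>beta_moment_recursion\<close> holds for each fixed x; integrating over
      \<open>\<nu>\<close> gives a recursion for the moments of \<open>\<mu>\<close>.\<close>
    have rec: "real (Suc p + k) * m (Suc p) = real k * (\<integral>x. x ^ Suc p \<partial>\<nu>) + real (Suc p) * l * m p" for p
    proof -
      have "real (Suc p + k) * m (Suc p) = (\<integral>x. real (Suc p + k) * J (Suc p) x \<partial>\<nu>)"
        unfolding m_J by simp
      also have "\<dots> = (\<integral>x. real k * x ^ Suc p + real (Suc p) * l * J p x \<partial>\<nu>)"
        unfolding J_def using beta_moment_recursion[OF k] by presburger
      also have "\<dots> = real k * (\<integral>x. x ^ Suc p \<partial>\<nu>) + real (Suc p) * l * m p"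
        unfolding m_J using int_X[of "Suc p"] int_J[of p]
        by (subst Bochner_Integration.integral_add) (auto simp del: power_Suc of_nat_Suc)
      finally show ?thesis .
    qed
    have main: "m p * fact (p + k) = hsym p (l # ls) * fact p * fact k" for p
    proof (induction p)
      case 0
      interpret \<mu>: prob_space \<mu> by fact
      show ?case by (simp add: m_def \<mu>.prob_space)
    next
      case (Suc p)
      have fk: "fact k = real k * fact (k - 1)" using k by (simp add: fact_reduce)
      \<comment> \<open>The tail lives on a simplex of dimension k - 1, so its moment of order p + 1
        carries the same factorial as the moment of order p of \<open>\<mu>\<close>. Multiplied by
        it, \<open>rec\<close> becomes the recursion of \<open>hsym\<close>.\<close>
      have idx: "fact (Suc p + (k - 1)) = (fact (p + k) :: real)" using k by simp
      have "m (Suc p) * fact (Suc p + k) = (real (Suc p + k) * m (Suc p)) * fact (p + k)"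
        by (simp add: algebra_simps)
      also have "\<dots> = real k * ((\<integral>x. x ^ Suc p \<partial>\<nu>) * fact (Suc p + (k - 1))) + real (Suc p) * l * (m p * fact (p + k))"
        unfolding rec idx by (simp add: algebra_simps)
      also have "\<dots> = hsym (Suc p) (l # ls) * fact (Suc p) * fact k"
        unfolding mom[folded k_def] Suc.IH fk by (simp add: algebra_simps)
      finally show ?case .
    qed
    show ?thesis
      using prob AE main by (intro exI[of _ \<mu>]) (auto simp: \<mu>_def m_def k_def)
  qed
qed simp

subsection \<open>Superpositions of probability measures\<close>

text \<open>Outer and inner regularity with error d/2 each; finiteness allows the two measures to be
  subtracted.\<close>

lemma finite_measure_regular_approximation:
  fixes E :: "'a::{second_countable_topology, complete_space} set"
  assumes "finite_measure M" "sets M = sets borel" "E \<in> sets borel" "d > 0"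
  obtains K U where "compact K" "K \<subseteq> E" "open U" "E \<subseteq> U" "measure M (U - K) < d"
proof -
  interpret finite_measure M by fact
  have d2: "ennreal (d/2) > 0" using assms by simp
  have fin: "emeasure M E < \<infinity>" by (simp add: less_top[symmetric])
  obtain U where U: "open U" "E \<subseteq> U" "emeasure M U < emeasure M E + ennreal (d/2)"
  proof -
    have "(INF U \<in> {U. E \<subseteq> U \<and> open U}. emeasure M U) < emeasure M E + ennreal (d/2)"
      using outer_regular[of M E] assms d2 fin by (auto simp: ennreal_add_left_cancel_less)
    then show ?thesis using that by (auto simp: INF_less_iff)
  qed
  obtain K where K: "compact K" "K \<subseteq> E" "emeasure M E < emeasure M K + ennreal (d/2)"
    using SUP_approx_ennreal[OF _ _ inner_regular, of "d/2" E M] assms fin by (auto intro: compact_empty)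
  have "ennreal (measure M U) < ennreal (measure M E + d/2)"
    using U(3) assms(4) by (simp add: emeasure_eq_measure)
  then have "measure M U < measure M E + d/2" by (simp add: ennreal_less_iff)
  moreover have "ennreal (measure M E) < ennreal (measure M K + d/2)"
    using K(3) assms(4) by (simp add: emeasure_eq_measure)
  then have "measure M E < measure M K + d/2" by (simp add: ennreal_less_iff)
  moreover have "measure M (U - K) = measure M U - measure M K"
    using U K assms by (intro finite_measure_Diff) (auto simp: compact_imp_closed)
  ultimately show ?thesis using that[of K U] U K by simp
qed

text \<open>Separates the measure theory from the exponential: an absolutely convergent matrix
  combination of probability measures carried by S.\<close>

locale measure_superposition =
  fixes I :: "'i set" and \<nu> :: "'i \<Rightarrow> real measure" and c :: "'i \<Rightarrow> complex^'n^'n" and S :: "real set"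
  assumes prob: "i \<in> I \<Longrightarrow> prob_space (\<nu> i)"
    and sets_\<nu>: "i \<in> I \<Longrightarrow> sets (\<nu> i) = sets borel"
    and S_borel: "S \<in> sets borel"
    and conc: "i \<in> I \<Longrightarrow> AE x in \<nu> i. x \<in> S"
    and c_summable: "(\<lambda>i. norm (c i)) summable_on I"
begin

definition superposition :: "real set \<Rightarrow> complex^'n^'n"
  where "superposition E = (\<Sum>\<^sub>\<infinity>i\<in>I. measure (\<nu> i) E *\<^sub>R c i)"

lemma abs_summable_bounded:
  assumes "\<And>i. i \<in> I \<Longrightarrow> norm (f i) \<le> b * norm (c i)"
  shows "(\<lambda>i. norm (f i)) summable_on I"
proof (rule Infinite_Sum.abs_summable_on_comparison_test)
  show "(\<lambda>i. norm (b * norm (c i))) summable_on I"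
    using summable_on_cmult_right[OF c_summable, of "\<bar>b\<bar>"] by (simp add: abs_mult)
  show "norm (f i) \<le> norm (b * norm (c i))" if "i \<in> I" for i
    using assms[OF that] by (simp add: abs_mult) (meson abs_ge_self mult_right_mono norm_ge_zero order_trans)
qed

lemma abs_summable_measure: "(\<lambda>i. norm (measure (\<nu> i) E *\<^sub>R c i)) summable_on I"
  by (rule abs_summable_bounded[of _ 1]) (auto intro!: mult_left_le_one_le prob_space.prob_le_1 prob)

text \<open>The sums over i and k are interchanged. For fixed i the norms sum over k to at most
  \<open>norm (c i)\<close>, so the double series converges absolutely.\<close>

lemma superposition_cadd: "vmeasure_cadd S superposition"
  unfolding vmeasure_cadd_def
proof safe
  fix F :: "nat \<Rightarrow> real set"
  assume F: "range F \<subseteq> borel_subsets S" and disj: "disjoint_family F"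
  define g where "g = (\<lambda>(i, k). measure (\<nu> i) (F k) *\<^sub>R c i)"
  have sums: "(\<lambda>k. measure (\<nu> i) (F k)) sums measure (\<nu> i) (\<Union>k. F k)" if "i \<in> I" for i
  proof -
    interpret prob_space "\<nu> i" using prob that .
    show ?thesis
      using F sets_\<nu>[OF that] by (intro finite_measure_UNION disj) (auto simp: borel_subsets_def)
  qed
  have has_sum: "((\<lambda>k. measure (\<nu> i) (F k)) has_sum measure (\<nu> i) (\<Union>k. F k)) UNIV" if "i \<in> I" for i
    by (rule sums_nonneg_imp_has_sum[OF sums[OF that]]) simp
  have inner: "((\<lambda>k. g (i, k)) has_sum measure (\<nu> i) (\<Union>k. F k) *\<^sub>R c i) UNIV" if "i \<in> I" for i
    unfolding g_def using has_sum_bounded_linear[OF bounded_linear_scaleR_left has_sum[OF that]] by simp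
  have inner': "((\<lambda>k. norm (g (i, k))) has_sum measure (\<nu> i) (\<Union>k. F k) * norm (c i)) UNIV"
    if "i \<in> I" for i
    unfolding g_def using has_sum_bounded_linear[OF bounded_linear_mult_left has_sum[OF that]] by simp
  have "(\<lambda>p. norm (g p)) summable_on I \<times> UNIV"
  proof (subst Infinite_Sum.abs_summable_on_Sigma_iff, safe)
    show "(\<lambda>k. norm (g (i, k))) summable_on UNIV" if "i \<in> I" for i
      using inner'[OF that] has_sum_imp_summable by blast
    show "(\<lambda>i. norm (\<Sum>\<^sub>\<infinity>k. norm (g (i, k)))) summable_on I"
      by (rule abs_summable_bounded[of _ 1])
         (auto simp: infsumI[OF inner'] intro!: mult_left_le_one_le prob_space.prob_le_1 prob)
  qed
  then have summ: "g summable_on I \<times> UNIV" by (rule abs_summable_summable)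
  then obtain s where s: "(g has_sum s) (I \<times> UNIV)" by (auto simp: summable_on_def)
  have "((\<lambda>i. measure (\<nu> i) (\<Union>k. F k) *\<^sub>R c i) has_sum s) I"
    by (rule has_sum_SigmaD[OF s inner])
  then have s_eq: "s = superposition (\<Union>k. F k)"
    by (simp add: superposition_def infsumI)
  have "((\<lambda>(k, i). g (i, k)) has_sum s) (UNIV \<times> I)"
    using s by (subst has_sum_swap[symmetric]) (simp add: case_prod_beta)
  then have "((\<lambda>k. superposition (F k)) has_sum s) UNIV"
    by (rule has_sum_SigmaD)
       (auto simp: superposition_def g_def intro!: has_sum_infsum abs_summable_summable abs_summable_measure)
  then show "(\<lambda>k. superposition (F k)) sums superposition (\<Union>k. F k)"
    using has_sum_imp_sums s_eq by blast
qed

text \<open>A finite set J carries all but e/3 of the total weight. Regularity of the finitely many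
  measures in J handles the rest, with a contribution of at most e/2.\<close>

lemma superposition_regular: "vmeasure_regular S superposition"
  unfolding vmeasure_regular_def
proof (intro ballI allI impI)
  fix E and e :: real assume E: "E \<in> borel_subsets S" and e: "e > 0"
  define T where "T = (\<Sum>\<^sub>\<infinity>i\<in>I. norm (c i))"
  have T: "T \<ge> 0" unfolding T_def by (rule infsum_nonneg) simp
  define d where "d = e / (2 * (T + 1))"
  have d: "d > 0" using e T by (simp add: d_def)
  obtain J where J: "finite J" "J \<subseteq> I" "dist (\<Sum>i\<in>J. norm (c i)) T \<le> e/3"
    using infsum_finite_approximation[OF c_summable, of "e/3"] e unfolding T_def by auto
  have summ_tail: "(\<lambda>i. norm (c i)) summable_on I - J"
    using c_summable by (rule summable_on_subset_banach) auto
  have T_split: "T = (\<Sum>i\<in>J. norm (c i)) + (\<Sum>\<^sub>\<infinity>i\<in>I-J. norm (c i))"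
    unfolding T_def using infsum_Un_disjoint[of "\<lambda>i. norm (c i)" J "I - J"] J summ_tail
    by (simp add: Un_absorb1)
  have "\<exists>K U. compact K \<and> K \<subseteq> E \<and> open U \<and> E \<subseteq> U \<and> measure (\<nu> i) (U - K) < d" if "i \<in> J" for i
  proof -
    interpret prob_space "\<nu> i" using prob that J by auto
    show ?thesis
      using finite_measure_regular_approximation[OF finite_measure_axioms, of E d] sets_\<nu>[of i] E d that J
      unfolding borel_subsets_def by (metis (no_types, lifting) mem_Collect_eq subsetD)
  qed
  then obtain K U where KU: "\<And>i. i \<in> J \<Longrightarrow> compact (K i)" "\<And>i. i \<in> J \<Longrightarrow> K i \<subseteq> E"
    "\<And>i. i \<in> J \<Longrightarrow> open (U i)" "\<And>i. i \<in> J \<Longrightarrow> E \<subseteq> U i" "\<And>i. i \<in> J \<Longrightarrow> measure (\<nu> i) (U i - K i) < d"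
    by metis
  \<comment> \<open>Finiteness of J keeps the union compact and the intersection open, and the
    difference of the two sets lies in \<open>U i - K i\<close> for every i in J.\<close>
  define K' U' where "K' = (\<Union>i\<in>J. K i)" and "U' = S \<inter> (\<Inter>i\<in>J. U i)"
  show "\<exists>K U. compact K \<and> K \<subseteq> E \<and> openin (top_of_set S) U \<and> E \<subseteq> U \<and>
        (\<forall>F \<in> borel_subsets S. F \<subseteq> U - K \<longrightarrow> norm (superposition F) < e)"
  proof (intro exI conjI ballI impI)
    show "compact K'" unfolding K'_def using KU J by (intro compact_UN) auto
    show "K' \<subseteq> E" unfolding K'_def using KU by auto
    show "openin (top_of_set S) U'"
      unfolding U'_def using KU J by (intro openin_open_Int open_INT) auto
    show "E \<subseteq> U'" unfolding U'_def using KU(4) E by (fastforce simp: borel_subsets_def)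
    fix F assume F: "F \<in> borel_subsets S" and sub: "F \<subseteq> U' - K'"
    have le_d: "measure (\<nu> i) F \<le> d" if "i \<in> J" for i
    proof -
      interpret prob_space "\<nu> i" using prob that J by auto
      have "measure (\<nu> i) F \<le> measure (\<nu> i) (U i - K i)"
        using sub that KU(1,3)[OF that] sets_\<nu>[of i] J
        by (intro finite_measure_mono) (auto simp: U'_def K'_def compact_imp_closed)
      then show ?thesis using KU(5)[OF that] by simp
    qed
    define h where "h i = measure (\<nu> i) F * norm (c i)" for i
    have summ_h: "h summable_on I"
      using abs_summable_measure[of F] by (simp add: h_def[abs_def])
    have h_tail: "(\<lambda>i. h i) summable_on I - J"
      using summ_h by (rule summable_on_subset_banach) auto
    have "norm (superposition F) \<le> (\<Sum>\<^sub>\<infinity>i\<in>I. h i)"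
      unfolding superposition_def h_def using norm_infsum_bound[OF abs_summable_measure[of F]] by simp
    also have "\<dots> = (\<Sum>i\<in>J. h i) + (\<Sum>\<^sub>\<infinity>i\<in>I-J. h i)"
      using infsum_Un_disjoint[of h J "I - J"] J h_tail by (simp add: Un_absorb1)
    also have "(\<Sum>i\<in>J. h i) \<le> (\<Sum>i\<in>J. d * norm (c i))"
      unfolding h_def using le_d by (intro sum_mono mult_right_mono) auto
    also have "(\<Sum>\<^sub>\<infinity>i\<in>I-J. h i) \<le> (\<Sum>\<^sub>\<infinity>i\<in>I-J. norm (c i))"
      using h_tail summ_tail
      by (rule infsum_mono) (simp_all add: h_def mult_left_le_one_le prob_space.prob_le_1 prob)
    also have "(\<Sum>\<^sub>\<infinity>i\<in>I-J. norm (c i)) \<le> e/3"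
      using J(3) T_split by (simp add: dist_real_def abs_le_iff)
    also have "(\<Sum>i\<in>J. d * norm (c i)) \<le> d * T"
      using T_split d infsum_nonneg[of "I - J" "\<lambda>i. norm (c i)"]
      by (simp flip: sum_distrib_left)
    also have "d * T + e/3 < e"
    proof -
      have "d * T \<le> d * (T + 1)" using d by simp
      also have "\<dots> = e/2" using T by (simp add: d_def divide_simps)
      finally show ?thesis using e by simp
    qed
    finally show "norm (superposition F) < e" by simp
  qed
qed

text \<open>For each i the simple sum integrates a step function within d of f on S, so it misses
  the integral of f by at most d; weighting with \<open>norm (c i)\<close> makes the total error at
  most d T.\<close>

lemma superposition_integral:
  assumes f: "f \<in> borel_measurable borel" and bound: "\<And>x. x \<in> S \<Longrightarrow> cmod (f x) \<le> b"
  shows "has_vm_integral superposition S f (\<Sum>\<^sub>\<infinity>i\<in>I. cscale (\<integral>x. f x \<partial>\<nu> i) (c i))"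
  unfolding has_vm_integral_def
proof (intro allI impI)
  fix e :: real assume e: "e > 0"
  define T where "T = (\<Sum>\<^sub>\<infinity>i\<in>I. norm (c i))"
  have T: "T \<ge> 0" unfolding T_def by (rule infsum_nonneg) simp
  \<comment> \<open>T + 1 in place of T keeps the quotient meaningful for T = 0 and makes d T < e
    strict.\<close>
  define d where "d = e / (T + 1)"
  have d: "d > 0" using e T by (simp add: d_def)
  have int_f: "integrable (\<nu> i) f" if "i \<in> I" for i
  proof -
    interpret prob_space "\<nu> i" using prob that .
    have "f \<in> borel_measurable (\<nu> i)" using f sets_\<nu>[OF that] measurable_cong_sets by blast
    then show ?thesis
      by (intro integrable_const_bound[of _ b]) (use conc[OF that] bound in \<open>auto elim!: eventually_mono\<close>)
  qed
  have le_b: "cmod (\<integral>x. f x \<partial>\<nu> i) \<le> b" if "i \<in> I" for i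
  proof -
    interpret prob_space "\<nu> i" using prob that .
    have "cmod (\<integral>x. f x \<partial>\<nu> i) \<le> (\<integral>x. cmod (f x) \<partial>\<nu> i)" by simp
    also have "\<dots> \<le> (\<integral>x. b \<partial>\<nu> i)"
      by (intro integral_mono_AE integrable_norm int_f that)
         (use conc[OF that] bound in \<open>auto elim!: eventually_mono\<close>)
    finally show ?thesis by (simp add: prob_space)
  qed
  have summ_int: "(\<lambda>i. norm (cscale (\<integral>x. f x \<partial>\<nu> i) (c i))) summable_on I"
    by (rule abs_summable_bounded[of _ b]) (auto simp: norm_cscale intro!: mult_right_mono le_b)
  show "\<exists>d>0. \<forall>P k. borel_partition S P \<longrightarrow> (\<forall>E\<in>P. \<forall>x\<in>E. cmod (f x - k E) < d) \<longrightarrow>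
      norm ((\<Sum>E\<in>P. cscale (k E) (superposition E)) - (\<Sum>\<^sub>\<infinity>i\<in>I. cscale (\<integral>x. f x \<partial>\<nu> i) (c i))) < e"
  proof (intro exI[of _ d] conjI d allI impI)
    fix P :: "real set set" and k :: "real set \<Rightarrow> complex"
    assume P: "borel_partition S P" and close: "\<forall>E\<in>P. \<forall>x\<in>E. cmod (f x - k E) < d"
    have fin: "finite P" using P by (simp add: borel_partition_def)
    define g where "g i = (\<Sum>E\<in>P. k E * of_real (measure (\<nu> i) E))" for i
    have hs: "((\<lambda>i. cscale (k E) (measure (\<nu> i) E *\<^sub>R c i)) has_sum cscale (k E) (superposition E)) I" for E
      unfolding superposition_def
      by (rule has_sum_bounded_linear[OF bounded_linear_cscale_right])
         (rule has_sum_infsum[OF abs_summable_summable[OF abs_summable_measure]])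
    have "((\<lambda>i. \<Sum>E\<in>P. cscale (k E) (measure (\<nu> i) E *\<^sub>R c i)) has_sum
              (\<Sum>E\<in>P. cscale (k E) (superposition E))) I"
      using fin by (induction P) (auto intro!: has_sum_add hs)
    moreover have "(\<Sum>E\<in>P. cscale (k E) (measure (\<nu> i) E *\<^sub>R c i)) = cscale (g i) (c i)" for i
      by (simp add: g_def cscale_scaleR bounded_bilinear.sum_left[OF bounded_bilinear_cscale])
    ultimately have hs1: "((\<lambda>i. cscale (g i) (c i)) has_sum (\<Sum>E\<in>P. cscale (k E) (superposition E))) I"
      by simp
    have hs2: "((\<lambda>i. cscale (\<integral>x. f x \<partial>\<nu> i) (c i)) has_sum (\<Sum>\<^sub>\<infinity>i\<in>I. cscale (\<integral>x. f x \<partial>\<nu> i) (c i))) I"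
      by (rule has_sum_infsum[OF abs_summable_summable[OF summ_int]])
    have diff: "((\<lambda>i. cscale (g i - (\<integral>x. f x \<partial>\<nu> i)) (c i)) has_sum
       ((\<Sum>E\<in>P. cscale (k E) (superposition E)) - (\<Sum>\<^sub>\<infinity>i\<in>I. cscale (\<integral>x. f x \<partial>\<nu> i) (c i)))) I"
      using has_sum_add[OF hs1 has_sum_bounded_linear[OF bounded_linear_minus[OF bounded_linear_ident] hs2]]
      by (simp add: bounded_bilinear.diff_left[OF bounded_bilinear_cscale])
    have le_d: "cmod (g i - (\<integral>x. f x \<partial>\<nu> i)) \<le> d" if "i \<in> I" for i
    proof -
      interpret prob_space "\<nu> i" using prob that .
      have P_sets: "E \<in> sets (\<nu> i)" if "E \<in> P" for E
        using P that sets_\<nu>[OF \<open>i \<in> I\<close>] by (auto simp: borel_partition_def borel_subsets_def)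
      define s where "s x = (\<Sum>E\<in>P. indicator E x *\<^sub>R k E)" for x
      have int_ind: "integrable (\<nu> i) (\<lambda>x. indicator E x *\<^sub>R k E)" if "E \<in> P" for E
        using P_sets[OF that] by (intro integrable_scaleR_left integrable_real_indicator) (auto simp: less_top[symmetric])
      have int_s: "integrable (\<nu> i) s" unfolding s_def by (intro Bochner_Integration.integrable_sum int_ind)
      have "(\<integral>x. s x \<partial>\<nu> i) = (\<Sum>E\<in>P. (\<integral>x. indicator E x *\<^sub>R k E \<partial>\<nu> i))"
        unfolding s_def by (intro Bochner_Integration.integral_sum int_ind)
      also have "\<dots> = g i"
        unfolding g_def by (intro sum.cong refl)
          (use P_sets sets.sets_into_space in \<open>auto simp: less_top[symmetric] scaleR_conv_of_real Int_absorb2\<close>)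
      finally have g_eq: "g i = (\<integral>x. s x \<partial>\<nu> i)" ..
      \<comment> \<open>The partition covers S and is disjoint, so exactly one cell contributes to
        \<open>s x\<close>.\<close>
      have close_s: "cmod (s x - f x) \<le> d" if x: "x \<in> S" for x
      proof -
        obtain E where E: "E \<in> P" "x \<in> E" using P x by (auto simp: borel_partition_def)
        have uniq: "x \<notin> E'" if "E' \<in> P" "E' \<noteq> E" for E'
          using P E that by (auto simp: borel_partition_def disjoint_def)
        have "s x = (\<Sum>E'\<in>{E}. indicator E' x *\<^sub>R k E')"
          unfolding s_def using fin E uniq by (intro sum.mono_neutral_right) auto
        then have "s x = k E" using E by simp
        moreover have "cmod (f x - k E) < d" using close E by blast
        ultimately show ?thesis by (simp add: norm_minus_commute)
      qed
      have "cmod (g i - (\<integral>x. f x \<partial>\<nu> i)) = cmod (\<integral>x. s x - f x \<partial>\<nu> i)"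
        using g_eq int_s int_f[OF that] by simp
      also have "\<dots> \<le> (\<integral>x. cmod (s x - f x) \<partial>\<nu> i)" by simp
      also have "\<dots> \<le> (\<integral>x. d \<partial>\<nu> i)"
        by (intro integral_mono_AE integrable_norm Bochner_Integration.integrable_diff int_f int_s that)
           (use conc[OF that] close_s in \<open>auto elim!: eventually_mono\<close>)
      finally show ?thesis by (simp add: prob_space)
    qed
    have hs_norm: "((\<lambda>i. d * norm (c i)) has_sum d * T) I"
      unfolding T_def by (intro has_sum_cmult_right has_sum_infsum c_summable)
    have "norm ((\<Sum>E\<in>P. cscale (k E) (superposition E)) - (\<Sum>\<^sub>\<infinity>i\<in>I. cscale (\<integral>x. f x \<partial>\<nu> i) (c i))) \<le> d * T"
      by (rule norm_infsum_le[OF diff hs_norm]) (auto simp: norm_cscale intro!: mult_right_mono le_d)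
    also have "d * T < e" using e T by (simp add: d_def field_simps)
    finally show "norm ((\<Sum>E\<in>P. cscale (k E) (superposition E))
        - (\<Sum>\<^sub>\<infinity>i\<in>I. cscale (\<integral>x. f x \<partial>\<nu> i) (c i))) < e" .
  qed
qed

text \<open>The weights are real, and the adjoint is bounded and linear over the reals, so it passes
  through the series.\<close>

lemma hermitian_superposition:
  assumes "\<And>i. i \<in> I \<Longrightarrow> hermitian (c i)"
  shows "hermitian (superposition E)"
proof -
  have hs: "((\<lambda>i. measure (\<nu> i) E *\<^sub>R c i) has_sum superposition E) I"
    unfolding superposition_def by (rule has_sum_infsum[OF abs_summable_summable[OF abs_summable_measure]])
  have "((\<lambda>i. adjoint_mat (measure (\<nu> i) E *\<^sub>R c i)) has_sum adjoint_mat (superposition E)) I"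
    by (rule has_sum_bounded_linear[OF bounded_linear_adjoint_mat hs])
  moreover have "adjoint_mat (measure (\<nu> i) E *\<^sub>R c i) = measure (\<nu> i) E *\<^sub>R c i" if "i \<in> I" for i
    using assms[OF that] by (simp only: scaleR_eq_cscale adjoint_mat_cscale hermitian_iff_adjoint complex_cnj_complex_of_real)
  ultimately have "((\<lambda>i. measure (\<nu> i) E *\<^sub>R c i) has_sum adjoint_mat (superposition E)) I"
    by (simp cong: has_sum_cong)
  then have "adjoint_mat (superposition E) = superposition E" using hs by (rule has_sum_unique)
  then show ?thesis by (simp add: hermitian_iff_adjoint)
qed

end

subsection \<open>The exponential as a superposition of Laplace transforms\<close>

lemma moment_le:
  fixes \<nu> :: "real measure"
  assumes "prob_space \<nu>" "sets \<nu> = sets borel" "AE x in \<nu>. x \<in> {a..b}"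
  shows "integrable \<nu> (\<lambda>x. \<bar>x\<bar> ^ p)" "(\<integral>x. \<bar>x\<bar> ^ p \<partial>\<nu>) \<le> max \<bar>a\<bar> \<bar>b\<bar> ^ p"
proof -
  interpret prob_space \<nu> by fact
  have AE_le: "AE x in \<nu>. \<bar>x\<bar> ^ p \<le> max \<bar>a\<bar> \<bar>b\<bar> ^ p"
    using assms(3) by eventually_elim (auto intro!: power_mono)
  have "(\<lambda>x::real. \<bar>x\<bar> ^ p) \<in> borel_measurable \<nu>"
    by (subst measurable_cong_sets[OF assms(2) refl]) measurable
  then show int: "integrable \<nu> (\<lambda>x. \<bar>x\<bar> ^ p)"
    by (intro integrable_const_bound[of _ "max \<bar>a\<bar> \<bar>b\<bar> ^ p"]) (use AE_le in auto)
  have "(\<integral>x. \<bar>x\<bar> ^ p \<partial>\<nu>) \<le> (\<integral>x. max \<bar>a\<bar> \<bar>b\<bar> ^ p \<partial>\<nu>)"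
    by (intro integral_mono_AE int AE_le) simp
  then show "(\<integral>x. \<bar>x\<bar> ^ p \<partial>\<nu>) \<le> max \<bar>a\<bar> \<bar>b\<bar> ^ p" by (simp add: prob_space)
qed

text \<open>The exponential series is integrated term by term; the integrated norms are dominated by
  the exponential series of \<open>cmod t * R\<close>.\<close>

lemma has_sum_exp_moments:
  fixes \<nu> :: "real measure" and t :: complex
  assumes "prob_space \<nu>" "sets \<nu> = sets borel" "AE x in \<nu>. x \<in> {a..b}"
  shows "((\<lambda>p. t ^ p / fact p * of_real (\<integral>x. x ^ p \<partial>\<nu>)) has_sum (\<integral>x. exp (t * of_real x) \<partial>\<nu>)) UNIV"
proof -
  interpret prob_space \<nu> by fact
  define R where "R = max \<bar>a\<bar> \<bar>b\<bar>"
  note int_abs = moment_le(1)[OF assms] and le = moment_le(2)[OF assms, folded R_def]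
  define f where "f p x = (t * complex_of_real x) ^ p / fact p" for p x
  have f_eq: "f p x = (t ^ p / fact p) * of_real (x ^ p)" for p x
    by (simp add: f_def power_mult_distrib)
  have norm_f: "norm (f p x) = cmod t ^ p / fact p * \<bar>x\<bar> ^ p" for p x
    by (simp add: f_def norm_divide norm_mult norm_power power_mult_distrib)
  have int_pow: "integrable \<nu> (\<lambda>x. x ^ p)" for p
  proof (rule Bochner_Integration.integrable_bound[OF int_abs[of p]])
    show "(\<lambda>x::real. x ^ p) \<in> borel_measurable \<nu>"
      by (subst measurable_cong_sets[OF assms(2) refl]) measurable
  qed (simp add: power_abs)
  have int_f: "integrable \<nu> (f p)" for p
    unfolding f_eq[abs_def] by (intro integrable_mult_right integrable_of_real int_pow)
  have summ_R: "summable (\<lambda>p. (cmod t * R) ^ p / fact p)"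
    using summable_exp[of "cmod t * R"] by (simp add: field_simps)
  have norm_int: "(\<integral>x. norm (f p x) \<partial>\<nu>) \<le> (cmod t * R) ^ p / fact p" for p
  proof -
    have "(\<integral>x. norm (f p x) \<partial>\<nu>) = cmod t ^ p / fact p * (\<integral>x. \<bar>x\<bar> ^ p \<partial>\<nu>)"
      unfolding norm_f by simp
    also have "\<dots> \<le> cmod t ^ p / fact p * R ^ p" by (intro mult_left_mono le) simp
    finally show ?thesis by (simp add: power_mult_distrib)
  qed
  have summ_int: "summable (\<lambda>p. \<integral>x. norm (f p x) \<partial>\<nu>)"
    by (rule summable_comparison_test'[OF summ_R, of 0]) (use norm_int in simp)
  have "summable (\<lambda>p. norm (f p x))" for x
    using summable_norm_exp[of "t * complex_of_real x"]
    by (simp add: f_def norm_divide norm_power divide_inverse norm_inverse scaleR_conv_of_real norm_mult mult.commute)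
  then have "(\<lambda>p. \<integral>x. f p x \<partial>\<nu>) sums (\<integral>x. (\<Sum>p. f p x) \<partial>\<nu>)"
    by (intro sums_integral int_f summ_int) simp
  moreover have "(\<Sum>p. f p x) = exp (t * of_real x)" for x
    by (simp add: f_def exp_def scaleR_conv_of_real divide_inverse mult.commute)
  ultimately have "(\<lambda>p. \<integral>x. f p x \<partial>\<nu>) sums (\<integral>x. exp (t * of_real x) \<partial>\<nu>)" by simp
  moreover have "summable (\<lambda>p. norm (\<integral>x. f p x \<partial>\<nu>))"
    by (rule summable_comparison_test'[OF summ_int, of 0]) simp
  ultimately have "((\<lambda>p. \<integral>x. f p x \<partial>\<nu>) has_sum (\<integral>x. exp (t * of_real x) \<partial>\<nu>)) UNIV"
    by (intro norm_summable_imp_has_sum)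
  moreover have "(\<integral>x. f p x \<partial>\<nu>) = t ^ p / fact p * of_real (\<integral>x. x ^ p \<partial>\<nu>)" for p
    by (simp only: f_eq integral_mult_right_zero integral_complex_of_real)
  ultimately show ?thesis by simp
qed

text \<open>In the moment condition \<open>length ls - 1\<close> is the number k of letters B, which
  is also the dimension of the simplex.\<close>

locale eigen_resolution =
  fixes A B :: "complex^'n^'n" and S :: "real set" and E :: "real \<Rightarrow> complex^'n^'n"
    and a b :: real and \<nu> :: "real list \<Rightarrow> real measure"
  assumes fin: "finite S"
    and eig: "r \<in> S \<Longrightarrow> A ** E r = r *\<^sub>R E r"
    and one: "(\<Sum>r\<in>S. E r) = mat 1"
    and prob: "ls \<noteq> [] \<Longrightarrow> set ls \<subseteq> S \<Longrightarrow> prob_space (\<nu> ls)"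
    and sets_borel: "ls \<noteq> [] \<Longrightarrow> set ls \<subseteq> S \<Longrightarrow> sets (\<nu> ls) = sets borel"
    and conc: "ls \<noteq> [] \<Longrightarrow> set ls \<subseteq> S \<Longrightarrow> AE x in \<nu> ls. x \<in> {a..b}"
    and moments: "ls \<noteq> [] \<Longrightarrow> set ls \<subseteq> S \<Longrightarrow>
      (\<integral>x. x ^ p \<partial>\<nu> ls) * fact (p + (length ls - 1)) = hsym p ls * fact p * fact (length ls - 1)"
begin

text \<open>The list determines k; recording k allows summation over lists of a fixed length
  first.\<close>

definition index :: "(nat \<times> real list) set"
  where "index = (SIGMA k:UNIV. lists_of_length S (Suc k))"

definition coeff :: "nat \<times> real list \<Rightarrow> complex^'n^'n"
  where "coeff = (\<lambda>(k, ls). (1 / fact k) *\<^sub>R word_coeff E B ls)"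

lemma index_D:
  assumes "(k, ls) \<in> index"
  shows "ls \<noteq> []" "set ls \<subseteq> S" "length ls - 1 = k"
  using assms by (auto simp: index_def lists_of_length_def)

text \<open>There are \<open>card S ^ Suc k\<close> lists for each k, each with a coefficient of
  norm at most \<open>K ^ Suc k / fact k\<close>: an exponential series dominates.\<close>

lemma coeff_summable: "(\<lambda>i. norm (coeff i)) summable_on index"
proof -
  obtain K where K: "K \<ge> 0" "\<And>ls. ls \<noteq> [] \<Longrightarrow> set ls \<subseteq> S \<Longrightarrow> norm (word_coeff E B ls) \<le> K ^ length ls"
    by (rule word_coeff_bound[OF fin, where E = E and B = B]) (rule that)
  define g where "g k = (\<Sum>ls\<in>lists_of_length S (Suc k). norm (coeff (k, ls)))" for k
  define q where "q = real (card S) * K"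
  have g0: "g k \<ge> 0" for k unfolding g_def by (intro sum_nonneg) simp
  have le: "g k \<le> q * (inverse (fact k) * q ^ k)" for k
  proof -
    have "g k \<le> (\<Sum>ls\<in>lists_of_length S (Suc k). K ^ Suc k / fact k)"
      unfolding g_def
    proof (rule sum_mono)
      fix ls assume "ls \<in> lists_of_length S (Suc k)"
      then have "ls \<noteq> []" "set ls \<subseteq> S" "length ls = Suc k" by (auto simp: lists_of_length_def)
      then have "norm (word_coeff E B ls) \<le> K ^ Suc k" using K(2)[of ls] by simp
      then show "norm (coeff (k, ls)) \<le> K ^ Suc k / fact k"
        unfolding coeff_def by (simp add: divide_right_mono)
    qed
    also have "\<dots> = q * (inverse (fact k) * q ^ k)"
      by (simp add: card_lists_of_length fin q_def power_mult_distrib field_simps)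
    finally show ?thesis .
  qed
  have "summable (\<lambda>k. q * (inverse (fact k) * q ^ k))"
    by (intro summable_mult summable_exp)
  then have "summable g"
    by (rule summable_comparison_test'[of _ 0]) (use g0 le in \<open>simp add: abs_of_nonneg\<close>)
  then have "g summable_on UNIV" using g0 summable_on_UNIV_nonneg_real_iff by blast
  moreover have "((\<lambda>ls. norm (coeff (k, ls))) has_sum g k) (lists_of_length S (Suc k))" for k
    unfolding g_def by (intro has_sum_finite finite_lists_of_length fin)
  ultimately show ?thesis
    unfolding index_def by (intro summable_on_SigmaI) auto
qed

definition laplace :: "complex \<Rightarrow> nat \<times> real list \<Rightarrow> complex"
  where "laplace t i = (\<integral>x. exp (t * of_real x) \<partial>\<nu> (snd i))"

text \<open>One absolutely convergent series over p and i is summed in two ways. Summing over p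
  first produces the Laplace transforms; grouping by N = p + k produces the exponential series,
  whose convergence is thereby shown too.\<close>

lemma mexp_eq_superposition:
  shows "((\<lambda>i. cscale (laplace t i) (coeff i)) has_sum mexp (cscale t A + B)) index"
    and "(\<lambda>N. (1 / fact N) *\<^sub>R mpow (cscale t A + B) N) sums mexp (cscale t A + B)"
proof -
  have ws: "word_sum A B p k = (\<Sum>ls\<in>lists_of_length S (Suc k). hsym p ls *\<^sub>R word_coeff E B ls)" for p k
    by (rule word_sum_eigen_expansion[OF _ one]) (rule eig)
  define R where "R = max \<bar>a\<bar> \<bar>b\<bar>"
  define u where "u p = (cmod t * R) ^ p / fact p" for p
  define m where "m p i = t ^ p / fact p * of_real (\<integral>x. x ^ p \<partial>\<nu> (snd i))" for p and i :: "nat \<times> real list"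
  define g where "g = (\<lambda>(p, i). cscale (m p i) (coeff i))"
  have u0: "u p \<ge> 0" for p by (simp add: u_def R_def)
  have u_summable: "u summable_on UNIV"
    using summable_exp[of "cmod t * R"] u0
    by (simp add: summable_on_UNIV_nonneg_real_iff u_def[abs_def] field_simps)
  have m_le: "cmod (m p i) \<le> u p" if "i \<in> index" for p i
  proof -
    obtain k ls where i: "i = (k, ls)" by (cases i)
    note D = index_D[OF that[unfolded i]]
    have "\<bar>\<integral>x. x ^ p \<partial>\<nu> ls\<bar> \<le> (\<integral>x. \<bar>x ^ p\<bar> \<partial>\<nu> ls)" by (rule integral_abs_bound)
    also have "\<dots> \<le> R ^ p"
      using moment_le(2)[OF prob sets_borel conc, of ls p] D by (simp add: power_abs R_def)
    finally have "cmod t ^ p / fact p * \<bar>\<integral>x. x ^ p \<partial>\<nu> ls\<bar> \<le> cmod t ^ p / fact p * R ^ p"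
      by (intro mult_left_mono) auto
    then show ?thesis
      by (simp add: m_def i u_def norm_mult norm_divide norm_power power_mult_distrib)
  qed
  \<comment> \<open>Moments of order p are at most R^p, so the product of the summable families
    \<open>u\<close> and \<open>norm (coeff i)\<close> dominates.\<close>
  have "(\<lambda>z. norm (g z)) summable_on UNIV \<times> index"
  proof (rule Infinite_Sum.abs_summable_on_comparison_test')
    define T where "T = (\<Sum>\<^sub>\<infinity>i\<in>index. norm (coeff i))"
    show "(\<lambda>(p, i). u p * norm (coeff i)) summable_on UNIV \<times> index"
    proof (rule summable_on_SigmaI)
      show "((\<lambda>i. case (p, i) of (p, i) \<Rightarrow> u p * norm (coeff i)) has_sum u p * T) index" for p
        unfolding T_def by (simp add: has_sum_cmult_right has_sum_infsum coeff_summable)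
      show "(\<lambda>p. u p * T) summable_on UNIV" by (rule summable_on_cmult_left[OF u_summable])
    qed (simp add: u0)
    show "norm (g z) \<le> (\<lambda>(p, i). u p * norm (coeff i)) z" if "z \<in> UNIV \<times> index" for z
      using that by (auto simp: g_def norm_cscale intro!: mult_right_mono m_le)
  qed
  then obtain s where s: "(g has_sum s) (UNIV \<times> index)"
    using abs_summable_summable unfolding summable_on_def by blast
  have "((\<lambda>(i, p). g (p, i)) has_sum s) (index \<times> UNIV)"
    by (rule iffD1[OF has_sum_swap s])
  then have 1: "((\<lambda>i. cscale (laplace t i) (coeff i)) has_sum s) index"
  proof (rule has_sum_SigmaD)
    fix i assume "i \<in> index"
    then have i: "snd i \<noteq> []" "set (snd i) \<subseteq> S" using index_D[of "fst i" "snd i"] by auto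
    have "((\<lambda>p. m p i) has_sum laplace t i) UNIV"
      unfolding m_def laplace_def by (rule has_sum_exp_moments[OF prob sets_borel conc]) (rule i)+
    then show "((\<lambda>p. (\<lambda>(i, p). g (p, i)) (i, p)) has_sum cscale (laplace t i) (coeff i)) UNIV"
      unfolding g_def using has_sum_bounded_linear[OF bounded_linear_cscale_left] by simp
  qed
  define Q where "Q N = (SIGMA k:{..N}. lists_of_length S (Suc k))" for N :: nat
  define h where "h = (\<lambda>(N, k, ls). g (N - k, k, ls))"
  \<comment> \<open>regroup by \<open>N = p + k\<close>, the exponent of \<open>tA + B\<close>\<close>
  define j i where "j = (\<lambda>(p :: nat, k :: nat, ls :: real list). (p + k, k, ls))"
    and "i = (\<lambda>(N :: nat, k :: nat, ls :: real list). (N - k, k, ls))"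
  have "(g has_sum s) (UNIV \<times> index) \<longleftrightarrow> (h has_sum s) (SIGMA N:UNIV. Q N)"
    by (rule has_sum_reindex_bij_witness[of _ i j])
       (auto simp: i_def j_def index_def Q_def h_def)
  then have "(h has_sum s) (SIGMA N:UNIV. Q N)" using s by simp
  then have "((\<lambda>N. (1 / fact N) *\<^sub>R mpow (cscale t A + B) N) has_sum s) UNIV"
  proof (rule has_sum_SigmaD)
    fix N :: nat
    \<comment> \<open>The factorials 1/p! of the Laplace series and 1/k! of the coefficient combine
      with the moment formula into 1/N!.\<close>
    have g_eq: "g (N - k, k, ls) = cscale (of_real (1 / fact N)) (cscale (t ^ (N - k)) (hsym (N - k) ls *\<^sub>R word_coeff E B ls))"
      if "k \<le> N" "ls \<in> lists_of_length S (Suc k)" for k ls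
    proof -
      have ls: "ls \<noteq> []" "set ls \<subseteq> S" "length ls - 1 = k" using that by (auto simp: lists_of_length_def)
      define \<mu> where "\<mu> = (\<integral>x. x ^ (N - k) \<partial>\<nu> ls)"
      have "\<mu> * fact N = hsym (N - k) ls * fact (N - k) * fact k"
        using moments[OF ls(1,2), of "N - k"] that(1) unfolding ls(3) \<mu>_def by simp
      then have "\<mu> / (fact (N - k) * fact k) = hsym (N - k) ls / fact N" by (simp add: field_simps)
      then have "t ^ (N - k) * of_real (\<mu> / (fact (N - k) * fact k)) = t ^ (N - k) * of_real (hsym (N - k) ls / fact N)"
        by (rule arg_cong)
      then have "t ^ (N - k) / fact (N - k) * of_real \<mu> * of_real (1 / fact k)
          = of_real (1 / fact N) * (t ^ (N - k) * of_real (hsym (N - k) ls))" by (simp add: field_simps)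
      then show ?thesis
        by (simp add: g_def m_def coeff_def scaleR_eq_cscale cscale_cscale \<mu>_def)
    qed
    have "(\<Sum>z\<in>Q N. h (N, z)) = (\<Sum>k\<le>N. \<Sum>ls\<in>lists_of_length S (Suc k). g (N - k, k, ls))"
      unfolding Q_def h_def by (subst sum.Sigma) (auto simp: finite_lists_of_length fin case_prod_beta')
    also have "\<dots> = (\<Sum>k\<le>N. cscale (of_real (1 / fact N)) (cscale (t ^ (N - k)) (word_sum A B (N - k) k)))"
      unfolding ws cscale_sum_right
      by (intro sum.cong refl g_eq) auto
    also have "\<dots> = (1 / fact N) *\<^sub>R mpow (cscale t A + B) N"
      by (simp only: mpow_affine scaleR_eq_cscale cscale_sum_right)
    finally show "((\<lambda>z. h (N, z)) has_sum (1 / fact N) *\<^sub>R mpow (cscale t A + B) N) (Q N)"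
      by (intro has_sum_finiteI) (auto simp: Q_def finite_lists_of_length fin)
  qed
  then have 2: "(\<lambda>N. (1 / fact N) *\<^sub>R mpow (cscale t A + B) N) sums s" by (rule has_sum_imp_sums)
  then have "s = mexp (cscale t A + B)" unfolding mexp_def by (rule sums_unique)
  then show "((\<lambda>i. cscale (laplace t i) (coeff i)) has_sum mexp (cscale t A + B)) index"
    and "(\<lambda>N. (1 / fact N) *\<^sub>R mpow (cscale t A + B) N) sums mexp (cscale t A + B)"
    using 1 2 by auto
qed

lemma laplace_cnj: "laplace (cnj t) i = cnj (laplace t i)"
proof -
  have "exp (cnj t * complex_of_real x) = cnj (exp (t * complex_of_real x))" for x
    by (simp only: exp_cnj complex_cnj_mult complex_cnj_complex_of_real)
  then show ?thesis unfolding laplace_def by (simp only: Bochner_Integration.integral_cnj)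
qed

text \<open>Taking Hermitian parts of the coefficients is harmless because \<open>exp (tA + B)\<close> at the
  conjugate of \<open>t\<close> is the adjoint of its value at \<open>t\<close>.\<close>

lemma mexp_eq_hermitian_superposition:
  assumes "hermitian A" "hermitian B"
  shows "((\<lambda>i. cscale (laplace t i) (herm_part (coeff i))) has_sum mexp (cscale t A + B)) index"
proof -
  let ?X = "\<lambda>t. cscale t A + B"
  have adj: "adjoint_mat (?X (cnj t)) = ?X t"
    using assms by (simp add: adjoint_mat_add adjoint_mat_cscale hermitian_iff_adjoint)
  have "((\<lambda>i. adjoint_mat (cscale (laplace (cnj t) i) (coeff i))) has_sum adjoint_mat (mexp (?X (cnj t)))) index"
    by (rule has_sum_bounded_linear[OF bounded_linear_adjoint_mat mexp_eq_superposition(1)])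
  then have "((\<lambda>i. cscale (laplace t i) (adjoint_mat (coeff i))) has_sum mexp (?X t)) index"
    by (simp only: adjoint_mat_mexp[OF mexp_eq_superposition(2)] adj adjoint_mat_cscale laplace_cnj complex_cnj_cnj)
  from has_sum_add[OF mexp_eq_superposition(1)[of t] this]
  have "((\<lambda>i. cscale (laplace t i) (coeff i + adjoint_mat (coeff i))) has_sum (mexp (?X t) + mexp (?X t))) index"
    by (simp only: cscale_add_right)
  from has_sum_bounded_linear[OF bounded_linear_scaleR_right[of "1/2"] this]
  have "((\<lambda>i. (1/2) *\<^sub>R cscale (laplace t i) (coeff i + adjoint_mat (coeff i))) has_sum mexp (?X t)) index"
    by (simp only: scaleR_half_double)
  moreover have "(1/2) *\<^sub>R cscale z Y = cscale z ((1/2) *\<^sub>R Y)" for z and Y :: "complex^'n^'n"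
    by (simp only: scaleR_eq_cscale cscale_cscale mult.commute)
  ultimately show ?thesis by (simp only: herm_part_def)
qed

end

section \<open>Choice of the simplex laws and assembly of the measure\<close>

theorem theorem7p1:
  fixes A B :: "complex^'n^'n" and lmin lmax :: real
  assumes herm: "hermitian A"
    and min_eig: "is_eigenvalue A (complex_of_real lmin)" "\<forall>c. is_eigenvalue A c \<longrightarrow> lmin \<le> Re c"
    and max_eig: "is_eigenvalue A (complex_of_real lmax)" "\<forall>c. is_eigenvalue A c \<longrightarrow> Re c \<le> lmax"
  shows "\<exists>M :: real set \<Rightarrow> complex^'n^'n.
           vmeasure_cadd {lmin..lmax} M \<and> vmeasure_regular {lmin..lmax} M \<and>
           (\<forall>t::complex. has_vm_integral M {lmin..lmax} (\<lambda>x. exp (t * complex_of_real x))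
                             (mexp (cscale t A + B))) \<and>
           (hermitian B \<longrightarrow> (\<forall>\<delta> \<in> borel_subsets {lmin..lmax}. hermitian (M \<delta>)))"
proof -
  have "\<exists>(S :: real set) E. finite S \<and> (\<forall>r\<in>S. is_eigenvalue A (of_real r)) \<and>
    (\<forall>r\<in>S. A ** E r = r *\<^sub>R E r) \<and> (\<Sum>r\<in>S. E r) = mat 1"
    by (rule hermitian_spectral_resolution[OF herm])
  then obtain S :: "real set" and E where S: "finite S" "\<forall>r\<in>S. is_eigenvalue A (of_real r)"
    and E: "\<forall>r\<in>S. A ** E r = r *\<^sub>R E r" "(\<Sum>r\<in>S. E r) = mat 1"
    by (elim exE conjE)
  have sub: "S \<subseteq> {lmin..lmax}" using S(2) min_eig(2) max_eig(2) by fastforce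
  define P where "P ls \<nu> \<longleftrightarrow> prob_space \<nu> \<and> sets \<nu> = sets borel \<and> (AE x in \<nu>. x \<in> {lmin..lmax}) \<and>
     (\<forall>p. (\<integral>x. x ^ p \<partial>\<nu>) * fact (p + (length ls - 1)) = hsym p ls * fact p * fact (length ls - 1))"
    for ls :: "real list" and \<nu> :: "real measure"
  \<comment> \<open>One law is chosen for each list. Outside nonempty lists over S the choice is
    arbitrary, which is why the locale conditions on \<open>\<nu>\<close> are restricted to those
    lists.\<close>
  define \<nu> where "\<nu> ls = (SOME \<nu>. P ls \<nu>)" for ls
  have \<nu>: "P ls (\<nu> ls)" if "ls \<noteq> []" "set ls \<subseteq> S" for ls
  proof -
    have "\<exists>\<nu>. P ls \<nu>" unfolding P_def using that sub by (intro simplex_projection_measure) auto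
    then show ?thesis unfolding \<nu>_def by (rule someI_ex)
  qed
  interpret R: eigen_resolution A B S E lmin lmax \<nu>
  proof (rule eigen_resolution.intro)
    show "finite S" "(\<Sum>r\<in>S. E r) = mat 1" by fact+
    show "A ** E r = r *\<^sub>R E r" if "r \<in> S" for r using E(1) that by (rule bspec)
    fix ls :: "real list" assume "ls \<noteq> []" "set ls \<subseteq> S"
    note P = \<nu>[OF this, unfolded P_def]
    show "prob_space (\<nu> ls)" "sets (\<nu> ls) = sets borel" "AE x in \<nu> ls. x \<in> {lmin..lmax}"
      by (rule P[THEN conjunct1] P[THEN conjunct2, THEN conjunct1]
          P[THEN conjunct2, THEN conjunct2, THEN conjunct1])+
    show "(\<integral>x. x ^ p \<partial>\<nu> ls) * fact (p + (length ls - 1)) = hsym p ls * fact p * fact (length ls - 1)" for p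
      by (rule P[THEN conjunct2, THEN conjunct2, THEN conjunct2, THEN spec])
  qed
  \<comment> \<open>Both choices of coefficients have the same superposition of Laplace transforms
    when B is Hermitian, so one M serves the integral formula and Hermitian values alike.\<close>
  define c where "c i = (if hermitian B then herm_part (R.coeff i) else R.coeff i)" for i
  have mexp: "((\<lambda>i. cscale (R.laplace t i) (c i)) has_sum mexp (cscale t A + B)) R.index" for t
    using R.mexp_eq_superposition(1) R.mexp_eq_hermitian_superposition[OF herm]
    by (cases "hermitian B") (simp_all add: c_def)
  interpret measure_superposition R.index "\<lambda>i. \<nu> (snd i)" c "{lmin..lmax}"
  proof (rule measure_superposition.intro)
    \<comment> \<open>Boundedness of \<open>herm_part\<close> carries summability over from
      \<open>R.coeff\<close> to its Hermitian parts.\<close>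
    obtain K where K: "\<And>X :: complex^'n^'n. norm (herm_part X) \<le> norm X * K"
      using bounded_linear.nonneg_bounded[OF bounded_linear_herm_part] by blast
    show "(\<lambda>i. norm (c i)) summable_on R.index"
    proof (cases "hermitian B")
      case True
      show ?thesis
      proof (rule Infinite_Sum.abs_summable_on_comparison_test')
        show "(\<lambda>i. norm (R.coeff i) * K) summable_on R.index"
          by (rule summable_on_cmult_left[OF R.coeff_summable])
      qed (simp add: c_def True K)
    qed (simp add: c_def R.coeff_summable)
    fix i assume "i \<in> R.index"
    then have "snd i \<noteq> []" "set (snd i) \<subseteq> S" using R.index_D[of "fst i" "snd i"] by auto
    then show "prob_space (\<nu> (snd i))" "sets (\<nu> (snd i)) = sets borel" "AE x in \<nu> (snd i). x \<in> {lmin..lmax}"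
      by (rule R.prob R.sets_borel R.conc; assumption)+
  qed simp
  have "has_vm_integral superposition {lmin..lmax} (\<lambda>x. exp (t * complex_of_real x)) (mexp (cscale t A + B))" for t
  proof -
    have cont: "continuous_on T (\<lambda>x. exp (t * complex_of_real x))" for T
      by (intro continuous_intros)
    have "bounded ((\<lambda>x. exp (t * complex_of_real x)) ` {lmin..lmax})"
      by (intro compact_imp_bounded compact_continuous_image cont) simp
    then obtain b where "\<And>x. x \<in> {lmin..lmax} \<Longrightarrow> cmod (exp (t * complex_of_real x)) \<le> b"
      unfolding bounded_iff by blast
    from superposition_integral[OF borel_measurable_continuous_onI[OF cont] this]
    show ?thesis using infsumI[OF mexp[of t]] unfolding R.laplace_def by simp
  qed
  moreover have "hermitian (superposition \<delta>)" if "hermitian B" for \<delta>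
    using that by (intro hermitian_superposition) (simp add: c_def hermitian_herm_part)
  ultimately show ?thesis
    using superposition_cadd superposition_regular by blast
qed

end
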